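(* Let $\omega$ be a non-degenerate metric of constant Riemannian curvature (for instance a flat metric such as the Euclidean or Minkowski metric) on an $n$-dimensional manifold $X$, and let $M$ be the differential module defined by the Killing operator $\mathcal{D}: T\to S_2T^*,\ \xi\mapsto \mathcal{L}(\xi)\omega$. Then $\mathrm{ext}^1(M)=0$ and $\mathrm{ext}^2(M)=0$, and there is no gap: if $\mathcal{D}_1$ generates the compatibility conditions of $\mathcal{D}$ and $\mathcal{D}_2$ generates the compatibility conditions of $\mathcal{D}_1$, then $ad(\mathcal{D})$ generates the compatibility conditions of $ad(\mathcal{D}_1)$, and $ad(\mathcal{D}_1)$ generates the compatibility conditions of $ad(\mathcal{D}_2)$. The situation is similar if one starts with the conformal Killing operator $\hat{\mathcal{D}}: T\to\{\Omega\in S_2T^*\mid \omega^{ij}\Omega_{ij}=0\}$, $\xi\mapsto\mathcal{L}(\xi)\hat\omega$, where $\hat\omega_{ij}=\omega_{ij}|\det\omega|^{-1/n}$ (so that $\hat{\mathcal{D}}\xi=0$ if and only if $\mathcal{L}(\xi)\omega=A(x)\,\omega$ for some function $A$): the same conclusions hold with $M$, $\mathcal{D}_1$, $\mathcal{D}_2$ replaced by the differential module defined by $\hat{\mathcal{D}}$ and the corresponding successive generating compatibility operators $\hat{\mathcal{D}}_1$, $\hat{\mathcal{D}}_2$.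
   Context: $T$ and $T^*$ are the tangent and cotangent bundles of $X$, $S_2T^*$ is the bundle of symmetric covariant 2-tensors, and $\mathcal{L}(\xi)$ is the Lie derivative along the vector field $\xi$. We work in local coordinates $x^1,\dots,x^n$. $K$ is a differential field of characteristic $0$ (of functions of $x$, with commuting derivations $\partial_1,\dots,\partial_n$) containing the coefficients of the operators considered, and $D=K[d_1,\dots,d_n]$ is the ring of linear differential operators with coefficients in $K$, where $d_i a=a d_i+\partial_i a$ for $a\in K$ and $d_id_j=d_jd_i$. A linear differential operator $\mathcal{D}:E\to F$ with coefficients in $K$, where $E,F$ have fiber dimensions $m,p$, is a $p\times m$ matrix with entries in $D$. The differential module it defines is the left $D$-module $M=D^m/(D^p\mathcal{D})$, i.e. the cokernel of right multiplication by this matrix $D^p\to D^m$. The extension modules are $\mathrm{ext}^i(M)=\mathrm{ext}^i_D(M,D)$. An operator $\mathcal{D}_1:F_0\to F_1$ generates the compatibility conditions (CC) of $\mathcal{D}:E\to F_0$ if the rows of $\mathcal{D}_1$ generate the left $D$-module of all differential relations $P$ with $P\mathcal{D}=0$. For a vector bundle $E$, put $ad(E)=\wedge^nT^*\otimes E^*$. The formal adjoint of $\mathcal{D}:E\to F$ is the operator $ad(\mathcal{D}):ad(F)\to ad(E)$ obtained by contracting $\mathcal{D}\xi$ with a test section of $ad(F)$ and integrating by parts modulo divergences; on scalar operators it is the anti-automorphism of $D$ with $ad(a)=a$ for $a\in K$ and $ad(d_i)=-d_i$, combined with transposition of matrices.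
   Formalization: The formal theorem assumes n ≥ 3, which the statement leaves out; the claim fails for n = 1 (ext^1(M) is nonzero for the Killing operator) and for n = 2 (ext^2(M) is nonzero for the Killing operator of a flat metric). *)

theory Defs
  imports "HOL-Analysis.Analysis" "HOL-Library.Poly_Mapping" "HOL-Library.Multiset"
begin

section \<open>Differential fields and the ring of linear differential operators\<close>

locale differential_field =
  fixes pd :: "'n::finite \<Rightarrow> 'k::field_char_0 \<Rightarrow> 'k"
  assumes pd_add: "pd i (a + b) = pd i a + pd i b"
    and pd_mult: "pd i (a * b) = pd i a * b + a * pd i b"
    and pd_commute: "pd i (pd j a) = pd j (pd i a)"

text \<open>
  The ring $D = K[d_1,\dots,d_n]$ in normal form: an element is a finite sum of terms
  $a_\mu d^\mu$ with the coefficients on the left. The monomial $d^\mu$ is a multiset of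
  indices, in which \<open>i\<close> occurs as often as $d_i$ occurs in $d^\mu$. Addition is that of
  \<open>\<Rightarrow>\<^sub>0\<close>. The product depends on the derivations \<open>pd\<close> and is \<open>dmul pd\<close>; the (commutative)
  convolution product of \<open>\<Rightarrow>\<^sub>0\<close> is never used.
\<close>

type_synonym ('n, 'k) dop = "'n multiset \<Rightarrow>\<^sub>0 'k"

definition cmul :: "'k::field_char_0 \<Rightarrow> ('n, 'k) dop \<Rightarrow> ('n, 'k) dop" where
  "cmul a P = (\<Sum>\<mu>\<in>Poly_Mapping.keys P. Poly_Mapping.single \<mu> (a * Poly_Mapping.lookup P \<mu>))"

text \<open>Left multiplication by $d_i$, from $d_i (a\,d^\mu) = a\,d_i d^\mu + (\partial_i a)\,d^\mu$.\<close>

definition dvar_mul :: "('n \<Rightarrow> 'k \<Rightarrow> 'k) \<Rightarrow> 'n \<Rightarrow> ('n, 'k::field_char_0) dop \<Rightarrow> ('n, 'k) dop" where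
  "dvar_mul pd i P =
     (\<Sum>\<mu>\<in>Poly_Mapping.keys P. Poly_Mapping.single (add_mset i \<mu>) (Poly_Mapping.lookup P \<mu>)
        + Poly_Mapping.single \<mu> (pd i (Poly_Mapping.lookup P \<mu>)))"

text \<open>\<open>fold_mset (dvar_mul pd) Q \<mu>\<close> is the product $d^\mu Q$; it does not depend on an order of the
  factors, as the \<open>dvar_mul pd i\<close> commute when the \<open>pd i\<close> do.\<close>

definition dmul :: "('n \<Rightarrow> 'k \<Rightarrow> 'k) \<Rightarrow> ('n, 'k::field_char_0) dop \<Rightarrow> ('n, 'k) dop \<Rightarrow> ('n, 'k) dop" where
  "dmul pd P Q =
     (\<Sum>\<mu>\<in>Poly_Mapping.keys P. cmul (Poly_Mapping.lookup P \<mu>) (fold_mset (dvar_mul pd) Q \<mu>))"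

text \<open>The formal adjoint of a scalar operator:
  $\sum_\mu a_\mu d^\mu \mapsto \sum_\mu (-1)^{|\mu|} d^\mu a_\mu$.\<close>

definition dadj :: "('n \<Rightarrow> 'k \<Rightarrow> 'k) \<Rightarrow> ('n, 'k::field_char_0) dop \<Rightarrow> ('n, 'k) dop" where
  "dadj pd P =
     (\<Sum>\<mu>\<in>Poly_Mapping.keys P. cmul ((- 1) ^ size \<mu>)
        (fold_mset (dvar_mul pd) (Poly_Mapping.single {#} (Poly_Mapping.lookup P \<mu>)) \<mu>))"


section \<open>Matrices of operators and compatibility conditions\<close>

text \<open>
  Vectors and matrices over $D$ are functions that vanish off finite index sets. Elements of
  $D^I$ are row vectors. An operator from a bundle with components indexed by \<open>J\<close> to one with
  components indexed by \<open>I\<close> is an \<open>I \<times> J\<close> matrix. Sections of the tangent bundle are indexed by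
  the type \<open>'n\<close> of coordinates, all other bundles by \<open>{..<p}\<close>, where \<open>p = 0\<close> is allowed.
\<close>

definition dvecs :: "'i set \<Rightarrow> ('i \<Rightarrow> ('n, 'k::field_char_0) dop) set" where
  "dvecs I = {x. \<forall>i. i \<notin> I \<longrightarrow> x i = 0}"

definition dmats :: "'i set \<Rightarrow> 'j set \<Rightarrow> ('i \<Rightarrow> 'j \<Rightarrow> ('n, 'k::field_char_0) dop) set" where
  "dmats I J = {A. \<forall>i j. i \<notin> I \<or> j \<notin> J \<longrightarrow> A i j = 0}"

definition row_mult ::
  "('n \<Rightarrow> 'k \<Rightarrow> 'k) \<Rightarrow> 'i set \<Rightarrow> ('i \<Rightarrow> ('n, 'k::field_char_0) dop)
    \<Rightarrow> ('i \<Rightarrow> 'j \<Rightarrow> ('n, 'k) dop) \<Rightarrow> ('j \<Rightarrow> ('n, 'k) dop)" where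
  "row_mult pd I x A = (\<lambda>j. \<Sum>i\<in>I. dmul pd (x i) (A i j))"

definition row_module ::
  "('n \<Rightarrow> 'k \<Rightarrow> 'k) \<Rightarrow> 'i set \<Rightarrow> ('i \<Rightarrow> 'j \<Rightarrow> ('n, 'k::field_char_0) dop) \<Rightarrow> ('j \<Rightarrow> ('n, 'k) dop) set" where
  "row_module pd I A = (\<lambda>x. row_mult pd I x A) ` dvecs I"

definition ad ::
  "('n \<Rightarrow> 'k \<Rightarrow> 'k) \<Rightarrow> ('i \<Rightarrow> 'j \<Rightarrow> ('n, 'k::field_char_0) dop) \<Rightarrow> ('j \<Rightarrow> 'i \<Rightarrow> ('n, 'k) dop)" where
  "ad pd A = (\<lambda>j i. dadj pd (A i j))"

text \<open>The operator \<open>B\<close>, with rows indexed by \<open>L\<close>, generates the compatibility conditions of the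
  operator \<open>A\<close>, with rows indexed by \<open>I\<close>.\<close>

definition generates_cc ::
  "('n \<Rightarrow> 'k \<Rightarrow> 'k) \<Rightarrow> 'l set \<Rightarrow> ('l \<Rightarrow> 'i \<Rightarrow> ('n, 'k::field_char_0) dop)
    \<Rightarrow> 'i set \<Rightarrow> ('i \<Rightarrow> 'j \<Rightarrow> ('n, 'k) dop) \<Rightarrow> bool" where
  "generates_cc pd L B I A \<longleftrightarrow>
     B \<in> dmats L I \<and> row_module pd L B = {P \<in> dvecs I. row_mult pd I P A = (\<lambda>_. 0)}"

definition no_gap ::
  "('n \<Rightarrow> 'k \<Rightarrow> 'k) \<Rightarrow> nat \<Rightarrow> 'j set \<Rightarrow> (nat \<Rightarrow> 'j \<Rightarrow> ('n, 'k::field_char_0) dop) \<Rightarrow> bool" where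
  "no_gap pd p J A \<longleftrightarrow>
     (\<forall>(q::nat) (r::nat) A1 A2.
        generates_cc pd {..<q} A1 {..<p} A \<longrightarrow>
        generates_cc pd {..<r} A2 {..<q} A1 \<longrightarrow>
          generates_cc pd J (ad pd A) {..<p} (ad pd A1) \<and>
          generates_cc pd {..<p} (ad pd A1) {..<q} (ad pd A2))"


section \<open>Left modules over the ring of operators and extension modules\<close>

record ('d, 'm) lmodule =
  mcarrier :: "'m set"
  madd :: "'m \<Rightarrow> 'm \<Rightarrow> 'm"
  mzero :: 'm
  msmult :: "'d \<Rightarrow> 'm \<Rightarrow> 'm"

definition lhom :: "('d, 'a) lmodule \<Rightarrow> ('d, 'b) lmodule \<Rightarrow> ('a \<Rightarrow> 'b) set" where
  "lhom M N = {f \<in> mcarrier M \<rightarrow>\<^sub>E mcarrier N.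
     (\<forall>x\<in>mcarrier M. \<forall>y\<in>mcarrier M. f (madd M x y) = madd N (f x) (f y)) \<and>
     (\<forall>P. \<forall>x\<in>mcarrier M. f (msmult M P x) = msmult N P (f x))}"

definition regular_module ::
  "('n \<Rightarrow> 'k \<Rightarrow> 'k) \<Rightarrow> (('n, 'k::field_char_0) dop, ('n, 'k) dop) lmodule" where
  "regular_module pd = \<lparr>mcarrier = UNIV, madd = (+), mzero = 0, msmult = dmul pd\<rparr>"

definition free_module ::
  "('n \<Rightarrow> 'k \<Rightarrow> 'k) \<Rightarrow> 'i set \<Rightarrow> (('n, 'k::field_char_0) dop, 'i \<Rightarrow> ('n, 'k) dop) lmodule" where
  "free_module pd I = \<lparr>mcarrier = dvecs I, madd = (\<lambda>x y i. x i + y i), mzero = (\<lambda>_. 0),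
     msmult = (\<lambda>P x i. dmul pd P (x i))\<rparr>"

definition coset_of :: "('d, 'm) lmodule \<Rightarrow> 'm set \<Rightarrow> 'm \<Rightarrow> 'm set" where
  "coset_of M N x = {madd M x y | y. y \<in> N}"

definition quotient_module :: "('d, 'm) lmodule \<Rightarrow> 'm set \<Rightarrow> ('d, 'm set) lmodule" where
  "quotient_module M N = \<lparr>mcarrier = coset_of M N ` mcarrier M,
     madd = (\<lambda>X Y. {madd M x y | x y. x \<in> X \<and> y \<in> Y}),
     mzero = N,
     msmult = (\<lambda>P X. {madd M (msmult M P x) y | x y. x \<in> X \<and> y \<in> N})\<rparr>"

definition differential_module ::
  "('n \<Rightarrow> 'k \<Rightarrow> 'k) \<Rightarrow> 'i set \<Rightarrow> 'j set \<Rightarrow> ('i \<Rightarrow> 'j \<Rightarrow> ('n, 'k::field_char_0) dop)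
    \<Rightarrow> (('n, 'k) dop, ('j \<Rightarrow> ('n, 'k) dop) set) lmodule" where
  "differential_module pd I J A = quotient_module (free_module pd J) (row_module pd I A)"

abbreviation free_rank ::
  "('n \<Rightarrow> 'k \<Rightarrow> 'k) \<Rightarrow> nat \<Rightarrow> (('n, 'k::field_char_0) dop, nat \<Rightarrow> ('n, 'k) dop) lmodule" where
  "free_rank pd m \<equiv> free_module pd {..<m}"

text \<open>A resolution
  $\dots \to D^{r_2} \stackrel{\varphi_1}{\to} D^{r_1} \stackrel{\varphi_0}{\to} D^{r_0}
    \stackrel{\varepsilon}{\to} M \to 0$.\<close>

definition free_resolution ::
  "('n \<Rightarrow> 'k \<Rightarrow> 'k) \<Rightarrow> (('n, 'k::field_char_0) dop, 'm) lmodule \<Rightarrow> (nat \<Rightarrow> nat)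
    \<Rightarrow> (nat \<Rightarrow> (nat \<Rightarrow> ('n, 'k) dop) \<Rightarrow> (nat \<Rightarrow> ('n, 'k) dop))
    \<Rightarrow> ((nat \<Rightarrow> ('n, 'k) dop) \<Rightarrow> 'm) \<Rightarrow> bool" where
  "free_resolution pd M r \<phi> \<epsilon> \<longleftrightarrow>
     \<epsilon> \<in> lhom (free_rank pd (r 0)) M \<and>
     \<epsilon> ` dvecs {..<r 0} = mcarrier M \<and>
     (\<forall>i. \<phi> i \<in> lhom (free_rank pd (r (Suc i))) (free_rank pd (r i))) \<and>
     \<phi> 0 ` dvecs {..<r 1} = {x \<in> dvecs {..<r 0}. \<epsilon> x = mzero M} \<and>
     (\<forall>i. \<phi> (Suc i) ` dvecs {..<r (Suc (Suc i))}
            = {x \<in> dvecs {..<r (Suc i)}. \<phi> i x = (\<lambda>_. 0)})"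

text \<open>The complex $\mathrm{Hom}_D(D^{r_i}, D)$, with differential $f \mapsto f \circ \varphi_i$.\<close>

definition cocycles ::
  "('n \<Rightarrow> 'k \<Rightarrow> 'k) \<Rightarrow> (nat \<Rightarrow> nat) \<Rightarrow> (nat \<Rightarrow> (nat \<Rightarrow> ('n, 'k::field_char_0) dop) \<Rightarrow> (nat \<Rightarrow> ('n, 'k) dop))
    \<Rightarrow> nat \<Rightarrow> ((nat \<Rightarrow> ('n, 'k) dop) \<Rightarrow> ('n, 'k) dop) set" where
  "cocycles pd r \<phi> i =
     {f \<in> lhom (free_rank pd (r i)) (regular_module pd). \<forall>x\<in>dvecs {..<r (Suc i)}. f (\<phi> i x) = 0}"

definition coboundaries ::
  "('n \<Rightarrow> 'k \<Rightarrow> 'k) \<Rightarrow> (nat \<Rightarrow> nat) \<Rightarrow> (nat \<Rightarrow> (nat \<Rightarrow> ('n, 'k::field_char_0) dop) \<Rightarrow> (nat \<Rightarrow> ('n, 'k) dop))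
    \<Rightarrow> nat \<Rightarrow> ((nat \<Rightarrow> ('n, 'k) dop) \<Rightarrow> ('n, 'k) dop) set" where
  "coboundaries pd r \<phi> i =
     (case i of
        0 \<Rightarrow> {\<lambda>x\<in>dvecs {..<r 0}. 0}
      | Suc j \<Rightarrow> (\<lambda>g. \<lambda>x\<in>dvecs {..<r (Suc j)}. g (\<phi> j x)) ` lhom (free_rank pd (r j)) (regular_module pd))"

text \<open>The elements of $\mathrm{ext}^i$ are the cosets of the coboundaries in the cocycles.\<close>

definition ext_of_resolution ::
  "('n \<Rightarrow> 'k \<Rightarrow> 'k) \<Rightarrow> (nat \<Rightarrow> nat) \<Rightarrow> (nat \<Rightarrow> (nat \<Rightarrow> ('n, 'k::field_char_0) dop) \<Rightarrow> (nat \<Rightarrow> ('n, 'k) dop))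
    \<Rightarrow> nat \<Rightarrow> ((nat \<Rightarrow> ('n, 'k) dop) \<Rightarrow> ('n, 'k) dop) set set" where
  "ext_of_resolution pd r \<phi> i =
     (\<lambda>f. (\<lambda>b. \<lambda>x\<in>dvecs {..<r i}. f x + b x) ` coboundaries pd r \<phi> i) ` cocycles pd r \<phi> i"

text \<open>
  $\mathrm{ext}^i_D(M, D) = 0$. As $D$ is left Noetherian, a finitely generated $M$ has a resolution
  by free modules of finite rank, and $\mathrm{ext}^i$ does not depend on it up to isomorphism; the
  definition quantifies over all of them instead of choosing one.
\<close>

definition ext_vanishes ::
  "('n \<Rightarrow> 'k \<Rightarrow> 'k) \<Rightarrow> nat \<Rightarrow> (('n, 'k::field_char_0) dop, 'm) lmodule \<Rightarrow> bool" where
  "ext_vanishes pd i M \<longleftrightarrow>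
     (\<forall>r \<phi> \<epsilon>. free_resolution pd M r \<phi> \<epsilon> \<longrightarrow> ext_of_resolution pd r \<phi> i = {coboundaries pd r \<phi> i})"


section \<open>Metrics of constant curvature\<close>

definition nondegenerate_metric :: "'k::field_char_0 ^ 'n::finite ^ 'n \<Rightarrow> bool" where
  "nondegenerate_metric \<omega> \<longleftrightarrow> transpose \<omega> = \<omega> \<and> det \<omega> \<noteq> 0"

text \<open>\<open>christoffel pd \<omega> k i j\<close> is $\gamma^k_{ij}$, and \<open>riemann pd \<omega> k l i j\<close> is $\rho^k_{l,ij}$.\<close>

definition christoffel ::
  "('n \<Rightarrow> 'k \<Rightarrow> 'k) \<Rightarrow> 'k::field_char_0 ^ 'n::finite ^ 'n \<Rightarrow> 'n \<Rightarrow> 'n \<Rightarrow> 'n \<Rightarrow> 'k" where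
  "christoffel pd \<omega> k i j =
     (\<Sum>r\<in>UNIV. matrix_inv \<omega> $ k $ r
        * (pd i (\<omega> $ r $ j) + pd j (\<omega> $ r $ i) - pd r (\<omega> $ i $ j))) / 2"

definition riemann ::
  "('n \<Rightarrow> 'k \<Rightarrow> 'k) \<Rightarrow> 'k::field_char_0 ^ 'n::finite ^ 'n \<Rightarrow> 'n \<Rightarrow> 'n \<Rightarrow> 'n \<Rightarrow> 'n \<Rightarrow> 'k" where
  "riemann pd \<omega> k l i j =
     pd i (christoffel pd \<omega> k l j) - pd j (christoffel pd \<omega> k l i)
       + (\<Sum>r\<in>UNIV. christoffel pd \<omega> r l j * christoffel pd \<omega> k r i
                  - christoffel pd \<omega> r l i * christoffel pd \<omega> k r j)"

definition constant_curvature ::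
  "('n \<Rightarrow> 'k \<Rightarrow> 'k) \<Rightarrow> 'k::field_char_0 ^ 'n::finite ^ 'n \<Rightarrow> bool" where
  "constant_curvature pd \<omega> \<longleftrightarrow>
     (\<exists>c. (\<forall>i. pd i c = 0) \<and>
       (\<forall>k l i j. riemann pd \<omega> k l i j
          = c * ((if k = i then \<omega> $ l $ j else 0) - (if k = j then \<omega> $ l $ i else 0))))"


section \<open>Killing and conformal Killing operators\<close>

definition symmetric_tensors :: "('k::field_char_0 ^ 'n::finite ^ 'n) set" where
  "symmetric_tensors = {\<Omega>. transpose \<Omega> = \<Omega>}"

definition tracefree_tensors :: "'k::field_char_0 ^ 'n::finite ^ 'n \<Rightarrow> ('k ^ 'n ^ 'n) set" where
  "tracefree_tensors \<omega> =
     {\<Omega> \<in> symmetric_tensors. (\<Sum>i\<in>UNIV. \<Sum>j\<in>UNIV. matrix_inv \<omega> $ i $ j * \<Omega> $ i $ j) = 0}"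

text \<open>A frame \<open>e 0, \<dots>, e (p - 1)\<close> of a bundle of covariant 2-tensors: a basis over $K$.\<close>

definition frame ::
  "('k::field_char_0 ^ 'n::finite ^ 'n) set \<Rightarrow> nat \<Rightarrow> (nat \<Rightarrow> 'k ^ 'n ^ 'n) \<Rightarrow> bool" where
  "frame S p e \<longleftrightarrow>
     (\<forall>k<p. e k \<in> S) \<and>
     (\<forall>\<Omega>\<in>S. \<exists>!c. (\<forall>k\<ge>p. c k = 0) \<and> (\<forall>i j. \<Omega> $ i $ j = (\<Sum>k<p. c k * e k $ i $ j)))"

text \<open>
  The Lie derivative of a symmetric covariant 2-tensor density \<open>t\<close> of weight \<open>w\<close>,
  $$(\mathcal{L}(\xi)t)_{ij} = t_{rj}\partial_i\xi^r + t_{ir}\partial_j\xi^r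
      + w\,t_{ij}\partial_r\xi^r + \xi^r\partial_r t_{ij},$$
  as an operator in \<open>\<xi>\<close>: \<open>lie_derivative pd w t i j r\<close> is the coefficient of $\xi^r$ in the
  component \<open>i j\<close>. The weight is 0 for tensors.
\<close>

definition lie_derivative ::
  "('n \<Rightarrow> 'k \<Rightarrow> 'k) \<Rightarrow> 'k::field_char_0 \<Rightarrow> 'k ^ 'n::finite ^ 'n \<Rightarrow> 'n \<Rightarrow> 'n \<Rightarrow> 'n \<Rightarrow> ('n, 'k) dop" where
  "lie_derivative pd w t i j r =
     Poly_Mapping.single {#i#} (t $ r $ j) + Poly_Mapping.single {#j#} (t $ i $ r)
       + Poly_Mapping.single {#r#} (w * t $ i $ j) + Poly_Mapping.single {#} (pd r (t $ i $ j))"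

text \<open>\<open>A\<close> is the matrix, with respect to the frame \<open>e\<close> of the target bundle, of the operator
  on vector fields with tensor components \<open>L i j r\<close>.\<close>

definition operator_matrix ::
  "nat \<Rightarrow> (nat \<Rightarrow> 'k::field_char_0 ^ 'n::finite ^ 'n) \<Rightarrow> ('n \<Rightarrow> 'n \<Rightarrow> 'n \<Rightarrow> ('n, 'k) dop)
    \<Rightarrow> (nat \<Rightarrow> 'n \<Rightarrow> ('n, 'k) dop) \<Rightarrow> bool" where
  "operator_matrix p e L A \<longleftrightarrow>
     A \<in> dmats {..<p} UNIV \<and> (\<forall>i j r. L i j r = (\<Sum>k<p. cmul (e k $ i $ j) (A k r)))"

definition is_killing_operator ::
  "('n \<Rightarrow> 'k \<Rightarrow> 'k) \<Rightarrow> 'k::field_char_0 ^ 'n::finite ^ 'n \<Rightarrow> nat \<Rightarrow> (nat \<Rightarrow> 'n \<Rightarrow> ('n, 'k) dop) \<Rightarrow> bool" where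
  "is_killing_operator pd \<omega> p A \<longleftrightarrow>
     (\<exists>e. frame symmetric_tensors p e \<and> operator_matrix p e (lie_derivative pd 0 \<omega>) A)"

text \<open>
  The factor \<open>\<delta>\<close> is $|\det\omega|^{-1/n}$. An abstract differential field has no absolute value, and
  \<open>\<delta>\<close> is characterized by $\delta^n \det\omega = \pm 1$; any two choices differ by a constant factor.
  Under a change of coordinates $\det\omega$ acquires the square of the Jacobian, so that
  $\hat\omega = \delta\omega$ is a tensor density, and its Lie derivative has weight $-2/n$.
\<close>

definition conformal_factor :: "'k::field_char_0 ^ 'n::finite ^ 'n \<Rightarrow> 'k \<Rightarrow> bool" where
  "conformal_factor \<omega> \<delta> \<longleftrightarrow> \<delta> ^ CARD('n) * det \<omega> = 1 \<or> \<delta> ^ CARD('n) * det \<omega> = - 1"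

definition is_conformal_killing_operator ::
  "('n \<Rightarrow> 'k \<Rightarrow> 'k) \<Rightarrow> 'k::field_char_0 ^ 'n::finite ^ 'n \<Rightarrow> nat \<Rightarrow> (nat \<Rightarrow> 'n \<Rightarrow> ('n, 'k) dop) \<Rightarrow> bool" where
  "is_conformal_killing_operator pd \<omega> p A \<longleftrightarrow>
     (\<exists>\<delta> e. conformal_factor \<omega> \<delta> \<and> frame (tracefree_tensors \<omega>) p e \<and>
       operator_matrix p e (lie_derivative pd (- 2 / of_nat CARD('n)) (\<chi> i j. \<delta> * \<omega> $ i $ j)) A)"

end

theory Submission
  imports Defs "HOL-Library.Function_Algebras"
begin

text \<open>
  The (conformal) Killing equations are of finite type, so that $M$ is finite-dimensional over $K$,
  and $\mathrm{ext}^i(M, D) = 0$ for $i < n$ then holds for the following reason. On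
  $\mathrm{Hom}_K(V, D)$ there are commuting operators $\nabla_i x = d_i \circ x - x \circ d_i$, and the
  $D$-linear maps are those with $\nabla x = 0$. A cocycle of a resolution of $M$ extends $K$-linearly,
  and the obstruction to a $D$-linear extension is a $\nabla$-closed 1-form (for $\mathrm{ext}^1$) or
  2-form (for $\mathrm{ext}^2$) with values in $\mathrm{Hom}_K(M, D)$. As $M$ is finite-dimensional, such
  forms have bounded order, and their top symbols live in the Koszul complex of
  $K[\xi_1,\dots,\xi_n]$, which is exact in degrees $1$ and $2$ when $n \geq 3$; so the obstruction is
  removed order by order. The adjoint translates the vanishing of $\mathrm{ext}^1$ and
  $\mathrm{ext}^2$ into the absence of gaps.
\<close>

section \<open>Modules over the ring of operators\<close>

text \<open>Absence of a gap concerns only the three operators \<open>A\<close>, \<open>A1\<close>,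
  \<open>A2\<close>, whereas ext is tested on every free resolution. Both are reduced to the same
  fact about consecutive maps \<open>\<phi>\<close>, \<open>\<psi>\<close> of free modules: a
  D-linear form that kills the kernel of one of these maps factors through it. For
  \<open>\<psi>\<close> the 2-form arises by a dimension shift. A D-linear form on the kernel of
  \<open>\<phi>\<close> produces a 1-form \<open>\<gamma>\<close> that is closed only on the image
  of \<open>\<phi>\<close>. Extended K-linearly to the whole free module it stops being closed, but
  its differential vanishes on the image and so lives on M. A primitive of that differential,
  vanishing on the image as well, corrects \<open>\<gamma>\<close> to a closed 1-form on the free
  module, and there it splits because free modules have no first extensions. Quotients are avoided
  throughout: an element of Hom_K(M, D) is a map on the free module that vanishes on a subspace
  \<open>R\<close>, and finite dimension of M means that a finite set spans modulo \<open>R\<close>.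
  Characteristic 0 and n > p make the constant k + n - p of the homotopy invertible.\<close>

lemma sum_keys_add:
  fixes g :: "'a \<Rightarrow> 'k::comm_monoid_add \<Rightarrow> 'v::comm_monoid_add"
  assumes "\<And>\<mu>. g \<mu> 0 = 0" and "\<And>\<mu> a b. g \<mu> (a + b) = g \<mu> a + g \<mu> b"
  shows "(\<Sum>\<mu>\<in>Poly_Mapping.keys (P + Q). g \<mu> (Poly_Mapping.lookup (P + Q) \<mu>))
       = (\<Sum>\<mu>\<in>Poly_Mapping.keys P. g \<mu> (Poly_Mapping.lookup P \<mu>))
       + (\<Sum>\<mu>\<in>Poly_Mapping.keys Q. g \<mu> (Poly_Mapping.lookup Q \<mu>))"
proof -
  let ?S = "Poly_Mapping.keys P \<union> Poly_Mapping.keys Q"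
  have *: "(\<Sum>\<mu>\<in>Poly_Mapping.keys R. g \<mu> (Poly_Mapping.lookup R \<mu>))
      = (\<Sum>\<mu>\<in>?S. g \<mu> (Poly_Mapping.lookup R \<mu>))" if "Poly_Mapping.keys R \<subseteq> ?S" for R
    by (rule sum.mono_neutral_left) (use that assms(1) in \<open>auto simp: in_keys_iff\<close>)
  have "Poly_Mapping.keys (P + Q) \<subseteq> ?S"
    by (rule Poly_Mapping.keys_add)
  then show ?thesis
    by (subst (1 2 3) *) (simp_all add: lookup_add assms(2) sum.distrib)
qed

lemma sum_keys_single:
  assumes "\<And>\<mu>. g \<mu> 0 = 0"
  shows "(\<Sum>\<mu>\<in>Poly_Mapping.keys (Poly_Mapping.single \<nu> c). g \<mu> (Poly_Mapping.lookup (Poly_Mapping.single \<nu> c) \<mu>)) = g \<nu> c"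
  using assms by (cases "c = 0") simp_all

text \<open>Operators are sums of terms, so additive identities in D need checking on a single term
  only; most ring laws below rest on this.\<close>

lemma poly_mapping_add_induct [case_names zero single add]:
  fixes P :: "'a \<Rightarrow>\<^sub>0 'b::comm_monoid_add"
  assumes "Q 0" and "\<And>\<mu> c. Q (Poly_Mapping.single \<mu> c)" and "\<And>R S. Q R \<Longrightarrow> Q S \<Longrightarrow> Q (R + S)"
  shows "Q P"
proof (induction P rule: Poly_Mapping.update_induct)
  case const
  then show ?case using assms(1) by simp
next
  case (update f a b)
  have "Poly_Mapping.update a b f = f + Poly_Mapping.single a b"
    using update(1) by (intro poly_mapping_eqI) (auto simp: lookup_add lookup_single when_def in_keys_iff lookup_update)
  then show ?case using update assms by simp
qed

context differential_field
begin

lemma pd_zero [simp]: "pd i 0 = 0"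
  using pd_add[of i 0 0] by simp

lemma pd_one [simp]: "pd i 1 = 0"
  using pd_mult[of i 1 1] by simp

end

text \<open>The rewrite rule would turn the unit of $D$ into the unit of the convolution product.\<close>

declare single_one [simp del]

lemma cmul_add_right: "cmul a (P + Q) = cmul a P + cmul a Q"
  unfolding cmul_def
  by (rule sum_keys_add[of "\<lambda>\<mu> x. Poly_Mapping.single \<mu> (a * x)"]) (simp_all add: distrib_left single_add)

lemma cmul_single [simp]: "cmul a (Poly_Mapping.single \<mu> c) = Poly_Mapping.single \<mu> (a * c)"
  unfolding cmul_def by (rule sum_keys_single[of "\<lambda>\<mu> x. Poly_Mapping.single \<mu> (a * x)"]) simp

lemma lookup_cmul [simp]: "Poly_Mapping.lookup (cmul a P) \<mu> = a * Poly_Mapping.lookup P \<mu>"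
proof (induction P rule: poly_mapping_add_induct)
  case zero
  show ?case by (simp add: cmul_def)
next
  case (single \<nu> c)
  show ?case by (simp add: lookup_single when_def)
qed (simp add: cmul_add_right lookup_add distrib_left)

lemma vector_space_cmul: "vector_space (cmul :: 'k::field_char_0 \<Rightarrow> ('n, 'k) dop \<Rightarrow> ('n, 'k) dop)"
  by unfold_locales (auto intro!: poly_mapping_eqI simp: lookup_add algebra_simps)

lemma cmul_zero [simp]: "cmul a 0 = 0"
  by (auto intro!: poly_mapping_eqI)

lemma cmul_one [simp]: "cmul 1 P = P"
  by (auto intro!: poly_mapping_eqI)

lemma linear_add: "Vector_Spaces.linear s t f \<Longrightarrow> f (x + y) = f x + f y"
  and linear_scale: "Vector_Spaces.linear s t f \<Longrightarrow> f (s c x) = t c (f x)"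
  and linear_zero: "Vector_Spaces.linear s t f \<Longrightarrow> f 0 = 0"
  and linear_diff: "Vector_Spaces.linear s t f \<Longrightarrow> f (x - y) = f x - f y"
  and linear_neg: "Vector_Spaces.linear s t f \<Longrightarrow> f (- x) = - f x"
  and linear_sum: "Vector_Spaces.linear s t f \<Longrightarrow> f (sum g A) = (\<Sum>i\<in>A. f (g i))"
  by (simp_all add: linear_iff_module_hom module_hom.add module_hom.scale module_hom.zero
      module_hom.diff module_hom.neg module_hom.sum)

lemmas linear_rules = linear_add linear_scale linear_zero linear_diff linear_neg linear_sum

lemma linearI:
  assumes "vector_space s" "vector_space t"
    and "\<And>x y. f (x + y) = f x + f y" "\<And>c x. f (s c x) = t c (f x)"
  shows "Vector_Spaces.linear s t f"
  using assms by (simp add: Vector_Spaces.linear_def module_hom_def module_hom_axioms_def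
      module_iff_vector_space)

text \<open>A left D-module is encoded as a K-space with commuting operators that obey the Leibniz
  rule. The product \<open>dmul pd\<close> depends on the derivations and is not the
  \<open>*\<close> of the type, while the argument needs K-linear bases and right inverses; this
  form makes both accessible.\<close>

locale dmodule = differential_field pd + vector_space scale
  for pd :: "'n::finite \<Rightarrow> 'k::field_char_0 \<Rightarrow> 'k"
    and scale :: "'k \<Rightarrow> 'v::ab_group_add \<Rightarrow> 'v" +
  fixes act :: "'n \<Rightarrow> 'v \<Rightarrow> 'v"
  assumes act_add: "act i (x + y) = act i x + act i y"
    and act_scale: "act i (scale c x) = scale (pd i c) x + scale c (act i x)"
    and act_commute: "act i (act j x) = act j (act i x)"
begin

lemma act_zero [simp]: "act i 0 = 0"
  using act_add[of i 0 0] by simp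

lemma act_minus: "act i (- x) = - act i x"
  using act_add[of i x "- x"] by (simp add: add_eq_0_iff)

lemma act_diff: "act i (x - y) = act i x - act i y"
  using act_add[of i x "- y"] by (simp add: act_minus)

lemma act_sum: "act i (sum f A) = (\<Sum>a\<in>A. act i (f a))"
  by (induction A rule: infinite_finite_induct) (simp_all add: act_add)

sublocale cf: comp_fun_commute act
  by standard (auto simp: fun_eq_iff act_commute)

lemmas fold_act [simp] = cf.fold_mset_add_mset

lemma fold_act_zero [simp]: "fold_mset act 0 \<mu> = 0"
  by (induction \<mu>) simp_all

lemma fold_act_add: "fold_mset act (x + y) \<mu> = fold_mset act x \<mu> + fold_mset act y \<mu>"
  by (induction \<mu>) (simp_all add: act_add)

definition app :: "('n, 'k) dop \<Rightarrow> 'v \<Rightarrow> 'v" where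
  "app P x = (\<Sum>\<mu>\<in>Poly_Mapping.keys P. scale (Poly_Mapping.lookup P \<mu>) (fold_mset act x \<mu>))"

lemma app_add_left: "app (P + Q) x = app P x + app Q x"
  unfolding app_def
  by (rule sum_keys_add[of "\<lambda>\<mu> c. scale c (fold_mset act x \<mu>)"]) (simp_all add: scale_left_distrib)

lemma app_zero_left [simp]: "app 0 x = 0"
  by (simp add: app_def)

lemma app_single: "app (Poly_Mapping.single \<mu> c) x = scale c (fold_mset act x \<mu>)"
  unfolding app_def by (rule sum_keys_single[of "\<lambda>\<mu> c. scale c (fold_mset act x \<mu>)"]) simp

lemma app_add_right: "app P (x + y) = app P x + app P y"
  by (induction P rule: poly_mapping_add_induct)
    (simp_all add: app_single app_add_left fold_act_add scale_right_distrib)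

lemma app_zero_right [simp]: "app P 0 = 0"
  by (simp add: app_def)

lemma app_sum_right: "app P (sum f A) = (\<Sum>a\<in>A. app P (f a))"
  by (induction A rule: infinite_finite_induct) (simp_all add: app_add_right)

lemma app_sum_left: "app (sum f A) x = (\<Sum>a\<in>A. app (f a) x)"
  by (induction A rule: infinite_finite_induct) (simp_all add: app_add_left)

lemma app_cmul: "app (cmul c P) x = scale c (app P x)"
  by (induction P rule: poly_mapping_add_induct)
    (simp_all add: app_single app_add_left cmul_add_right scale_right_distrib)

end

context differential_field
begin

lemma dvar_mul_add: "dvar_mul pd i (P + Q) = dvar_mul pd i P + dvar_mul pd i Q"
  unfolding dvar_mul_def
  by (rule sum_keys_add[of "\<lambda>\<mu> c. Poly_Mapping.single (add_mset i \<mu>) c + Poly_Mapping.single \<mu> (pd i c)"])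
    (simp_all add: single_add pd_add)

lemma dvar_mul_single:
  "dvar_mul pd i (Poly_Mapping.single \<mu> c)
    = Poly_Mapping.single (add_mset i \<mu>) c + Poly_Mapping.single \<mu> (pd i c)"
  unfolding dvar_mul_def
  by (rule sum_keys_single[of "\<lambda>\<mu> c. Poly_Mapping.single (add_mset i \<mu>) c + Poly_Mapping.single \<mu> (pd i c)"])
    simp

lemma lookup_dvar_mul:
  "Poly_Mapping.lookup (dvar_mul pd i P) \<mu>
    = (if i \<in># \<mu> then Poly_Mapping.lookup P (\<mu> - {#i#}) else 0) + pd i (Poly_Mapping.lookup P \<mu>)"
proof (induction P rule: poly_mapping_add_induct)
  case zero
  show ?case by (simp add: dvar_mul_def)
next
  case (single \<nu> c)
  have "add_mset i \<nu> = \<mu> \<longleftrightarrow> i \<in># \<mu> \<and> \<nu> = \<mu> - {#i#}"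
    by auto
  then show ?case by (auto simp: dvar_mul_single lookup_add lookup_single when_def)
qed (simp add: dvar_mul_add lookup_add pd_add)

sublocale D: dmodule pd "cmul :: 'k \<Rightarrow> ('n, 'k) dop \<Rightarrow> ('n, 'k) dop" "dvar_mul pd"
proof -
  interpret vector_space "cmul :: 'k \<Rightarrow> ('n, 'k) dop \<Rightarrow> ('n, 'k) dop"
    by (rule vector_space_cmul)
  show "dmodule pd (cmul :: 'k \<Rightarrow> ('n, 'k) dop \<Rightarrow> ('n, 'k) dop) (dvar_mul pd)"
  proof unfold_locales
    fix i j c and x y :: "('n, 'k) dop"
    show "dvar_mul pd i (x + y) = dvar_mul pd i x + dvar_mul pd i y"
      by (rule dvar_mul_add)
    show "dvar_mul pd i (cmul c x) = cmul (pd i c) x + cmul c (dvar_mul pd i x)"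
      by (auto intro!: poly_mapping_eqI simp: lookup_dvar_mul lookup_add pd_mult algebra_simps)
    show "dvar_mul pd i (dvar_mul pd j x) = dvar_mul pd j (dvar_mul pd i x)"
      by (induction x rule: poly_mapping_add_induct)
        (simp_all add: dvar_mul_single dvar_mul_add pd_commute add_mset_commute algebra_simps,
          simp add: dvar_mul_def)
  qed
qed

lemma dmul_eq_app: "dmul pd = D.app"
  by (simp add: fun_eq_iff dmul_def D.app_def)

end

context dmodule
begin

lemma app_dvar_mul: "app (dvar_mul pd i P) x = act i (app P x)"
  by (induction P rule: poly_mapping_add_induct)
    (simp_all add: dvar_mul_single dvar_mul_add app_single app_add_left act_add act_scale)

lemma app_fold: "app (fold_mset (dvar_mul pd) Q \<mu>) x = fold_mset act (app Q x) \<mu>"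
  by (induction \<mu>) (simp_all add: app_dvar_mul)

text \<open>One law with two uses: for D acting on itself it is associativity of the product, and
  for the opposite action on D it says that the adjoint reverses products.\<close>

lemma app_dmul: "app (dmul pd P Q) x = app P (app Q x)"
  by (induction P rule: poly_mapping_add_induct)
    (simp_all add: dmul_eq_app D.app_single D.app_add_left app_add_left app_cmul app_fold app_single)

lemma app_const: "app (Poly_Mapping.single {#} c) x = scale c x"
  by (simp add: app_single)

lemma app_var: "app (Poly_Mapping.single {#i#} 1) x = act i x"
  by (simp add: app_single)

end

text \<open>The adjoint is the action of $D$ on $1$ through the left module structure
  $c \cdot x = x c$, $d_i \cdot x = - x d_i$.\<close>

context differential_field
begin

abbreviation (input) dconst :: "'k \<Rightarrow> ('n, 'k) dop" where
  "dconst \<equiv> Poly_Mapping.single {#}"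

abbreviation (input) dvar :: "'n \<Rightarrow> ('n, 'k) dop" where
  "dvar i \<equiv> Poly_Mapping.single {#i#} 1"

lemma dmul_assoc: "dmul pd (dmul pd P Q) R = dmul pd P (dmul pd Q R)"
  using D.app_dmul unfolding dmul_eq_app .

lemma dmul_one_right [simp]: "dmul pd P (dconst 1) = P"
proof -
  have *: "fold_mset (dvar_mul pd) (dconst 1) \<mu> = Poly_Mapping.single \<mu> 1" for \<mu>
    by (induction \<mu>) (simp_all add: dvar_mul_single)
  show ?thesis
    by (induction P rule: poly_mapping_add_induct)
      (simp_all add: dmul_eq_app D.app_single D.app_add_left *)
qed

lemma dmul_const: "dmul pd (dconst c) P = cmul c P"
  by (simp add: dmul_eq_app D.app_const)

lemma dmul_one_left [simp]: "dmul pd (dconst 1) P = P"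
  by (simp add: dmul_const)

lemma dmul_var: "dmul pd (dvar i) P = dvar_mul pd i P"
  by (simp add: dmul_eq_app D.app_var)

lemma dmul_zero_left [simp]: "dmul pd 0 P = 0" and dmul_zero_right [simp]: "dmul pd P 0 = 0"
  by (simp_all add: dmul_eq_app)

lemma dmul_add_left: "dmul pd (P + Q) R = dmul pd P R + dmul pd Q R"
  and dmul_add_right: "dmul pd R (P + Q) = dmul pd R P + dmul pd R Q"
  by (simp_all add: dmul_eq_app D.app_add_left D.app_add_right)

lemma dmul_minus_right: "dmul pd R (- P) = - dmul pd R P"
  using dmul_add_right[of R P "- P"] by (simp add: add_eq_0_iff)

lemma dmul_cmul_left: "dmul pd (cmul c P) Q = cmul c (dmul pd P Q)"
  by (simp add: dmul_eq_app D.app_cmul)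

lemma dmul_dvar_mul_left: "dmul pd (dvar_mul pd i P) Q = dvar_mul pd i (dmul pd P Q)"
  by (simp add: dmul_eq_app D.app_dvar_mul)

lemma dmul_sum_left: "dmul pd (sum f A) R = (\<Sum>a\<in>A. dmul pd (f a) R)"
  and dmul_sum_right: "dmul pd R (sum f A) = (\<Sum>a\<in>A. dmul pd R (f a))"
  by (simp_all add: dmul_eq_app D.app_sum_left D.app_sum_right)

section \<open>The formal adjoint as an involutive anti-automorphism\<close>

lemma dmodule_opposite:
  "dmodule pd (\<lambda>c P. dmul pd P (dconst c)) (\<lambda>i P. - dmul pd P (dvar i))"
proof (unfold_locales, goal_cases)
  \<comment> \<open>Goals 5 to 7 are additivity, the Leibniz rule and commutation of the action;
    goal 3 compares \<open>x b a\<close> with \<open>x (a b)\<close> and uses that K is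
    commutative.\<close>
  case (5 i x y)
  then show ?case by (simp add: dmul_add_left)
next
  case (6 i c x)
  have "dmul pd (dvar i) (dconst c) = dmul pd (dconst c) (dvar i) + dconst (pd i c)"
    by (simp add: dmul_var dmul_const dvar_mul_single)
  then have "dmul pd (dmul pd x (dvar i)) (dconst c)
      = dmul pd (dmul pd x (dconst c)) (dvar i) + dmul pd x (dconst (pd i c))"
    by (simp add: dmul_assoc dmul_add_right)
  moreover have "dmul pd (- P) Q = - dmul pd P Q" for P Q
    using dmul_add_left[of P "- P" Q] by (simp add: add_eq_0_iff)
  ultimately show ?case by simp
next
  case (7 i j x)
  have "dmul pd (dvar i) (dvar j) = dmul pd (dvar j) (dvar i)"
    by (simp add: dmul_var dvar_mul_single add_mset_commute)
  moreover have "dmul pd (- P) Q = - dmul pd P Q" for P Q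
    using dmul_add_left[of P "- P" Q] by (simp add: add_eq_0_iff)
  ultimately show ?case by (simp add: dmul_assoc)
next
  case (3 a b x)
  then show ?case by (simp add: dmul_assoc dmul_const mult.commute)
qed (simp_all add: dmul_add_left dmul_add_right single_add)

lemma dadj_add: "dadj pd (P + Q) = dadj pd P + dadj pd Q"
  unfolding dadj_def
proof (rule sum_keys_add[of "\<lambda>\<mu> c. cmul ((- 1) ^ size \<mu>) (fold_mset (dvar_mul pd) (dconst c) \<mu>)"])
qed (simp_all add: single_add D.fold_act_add cmul_add_right)

lemma dadj_zero [simp]: "dadj pd 0 = 0"
  by (simp add: dadj_def)

lemma dadj_single:
  "dadj pd (Poly_Mapping.single \<mu> c) = cmul ((- 1) ^ size \<mu>) (fold_mset (dvar_mul pd) (dconst c) \<mu>)"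
  unfolding dadj_def
  by (rule sum_keys_single[of "\<lambda>\<mu> c. cmul ((- 1) ^ size \<mu>) (fold_mset (dvar_mul pd) (dconst c) \<mu>)"]) simp

lemma dadj_sum: "dadj pd (sum f A) = (\<Sum>a\<in>A. dadj pd (f a))"
  by (induction A rule: infinite_finite_induct) (simp_all add: dadj_add)

lemma dadj_const [simp]: "dadj pd (dconst c) = dconst c"
  by (simp add: dadj_single)

text \<open>A term \<open>c d^\<mu>\<close> acts by right multiplication with
  \<open>(-1)^|\<mu>| d^\<mu> c\<close>, which is its adjoint. At \<open>Q = 1\<close> this recovers
  \<open>dadj pd P\<close>.\<close>

lemma opposite_app:
  "dmodule.app (\<lambda>c P. dmul pd P (dconst c)) (\<lambda>i P. - dmul pd P (dvar i)) P Q = dmul pd Q (dadj pd P)"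
proof -
  interpret O: dmodule pd "\<lambda>c P. dmul pd P (dconst c)" "\<lambda>i P. - dmul pd P (dvar i)"
    by (rule dmodule_opposite)
  have fold: "fold_mset (\<lambda>i P. - dmul pd P (dvar i)) Q \<mu>
      = cmul ((- 1) ^ size \<mu>) (dmul pd Q (Poly_Mapping.single \<mu> 1))" for \<mu> Q
  proof (induction \<mu> arbitrary: Q)
    case (add i \<mu>)
    have "fold_mset (\<lambda>i P. - dmul pd P (dvar i)) Q (add_mset i \<mu>)
        = fold_mset (\<lambda>i P. - dmul pd P (dvar i)) (- dmul pd Q (dvar i)) \<mu>"
      by (simp only: O.cf.fold_mset_fun_left_comm O.fold_act)
    also have "\<dots> = cmul ((- 1) ^ size \<mu>) (dmul pd (- dmul pd Q (dvar i)) (Poly_Mapping.single \<mu> 1))"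
      by (rule add)
    also have "dmul pd (- dmul pd Q (dvar i)) (Poly_Mapping.single \<mu> 1)
      = - dmul pd Q (Poly_Mapping.single (add_mset i \<mu>) 1)"
      using dmul_add_left[of "dmul pd Q (dvar i)" "- dmul pd Q (dvar i)"]
      by (simp add: dmul_assoc dmul_var dvar_mul_single add_eq_0_iff)
    finally show ?case by simp
  qed simp
  have f2: "fold_mset (dvar_mul pd) (dconst c) \<mu> = dmul pd (Poly_Mapping.single \<mu> 1) (dconst c)" for c \<mu>
    by (simp add: dmul_eq_app D.app_single)
  \<comment> \<open>A general scalar does not move past \<open>X\<close>, since \<open>X\<close>
    differentiates it; a sign does.\<close>
  have cm: "cmul ((-1)^k) (dmul pd X Y) = dmul pd X (cmul ((-1)^k) Y)" for k X Y
    by (cases "even k") (simp_all add: dmul_minus_right)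
  show ?thesis
    by (induction P rule: poly_mapping_add_induct)
      (simp_all add: O.app_single O.app_add_left dadj_add dmul_add_right fold dadj_single f2 dmul_assoc dmul_cmul_left
         flip: cm)
qed

lemma dadj_dmul: "dadj pd (dmul pd P Q) = dmul pd (dadj pd Q) (dadj pd P)"
proof -
  interpret O: dmodule pd "\<lambda>c P. dmul pd P (dconst c)" "\<lambda>i P. - dmul pd P (dvar i)"
    by (rule dmodule_opposite)
  show ?thesis
    using O.app_dmul[of P Q "dconst 1"] by (simp add: opposite_app)
qed

text \<open>The square of an anti-automorphism preserves products, and this one fixes K and every
  \<open>d_i\<close>, which generate D.\<close>

lemma dadj_dadj [simp]: "dadj pd (dadj pd P) = P"
proof -
  have var: "dadj pd (dvar i) = - dvar i" for i
    by (simp add: dadj_single dvar_mul_single single_uminus)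
  have neg: "dadj pd (- P) = - dadj pd P" for P
    using dadj_add[of P "- P"] by (simp add: add_eq_0_iff)
  have *: "dadj pd (dadj pd (Poly_Mapping.single \<mu> 1)) = Poly_Mapping.single \<mu> 1" for \<mu>
  proof (induction \<mu>)
    case (add i \<mu>)
    have "Poly_Mapping.single (add_mset i \<mu>) 1 = dmul pd (dvar i) (Poly_Mapping.single \<mu> 1)"
      by (simp add: dmul_var dvar_mul_single)
    then show ?case
      by (simp only: dadj_dmul var neg add) simp
  qed simp
  show ?thesis
  proof (induction P rule: poly_mapping_add_induct)
    case (single \<mu> c)
    have "Poly_Mapping.single \<mu> c = dmul pd (dconst c) (Poly_Mapping.single \<mu> 1)"
      by (simp add: dmul_const)
    then show ?case
      by (simp only: dadj_dmul * dadj_const)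
  qed (simp_all add: dadj_add)
qed

end

section \<open>Extension of linear maps along a finite cokernel\<close>

lemma finite_lookup_add_mset: "finite {\<nu>. g \<nu> * Poly_Mapping.lookup (P :: 'n multiset \<Rightarrow>\<^sub>0 'k::mult_zero) (add_mset i \<nu>) \<noteq> 0}"
proof (rule finite_subset)
  show "{\<nu>. g \<nu> * Poly_Mapping.lookup P (add_mset i \<nu>) \<noteq> 0} \<subseteq> add_mset i -` Poly_Mapping.keys P"
    by (auto simp: in_keys_iff)
  show "finite (add_mset i -` Poly_Mapping.keys P)"
    by (intro finite_vimageI) (auto simp: inj_def)
qed

text \<open>The derivative with respect to \<xi>_i of the full symbol. It is K-linear: the
  coefficients are not differentiated.\<close>

definition symbol_deriv :: "'n \<Rightarrow> ('n, 'k::field_char_0) dop \<Rightarrow> ('n, 'k) dop" where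
  "symbol_deriv i P =
     Abs_poly_mapping (\<lambda>\<nu>. of_nat (count \<nu> i + 1) * Poly_Mapping.lookup P (add_mset i \<nu>))"

lemma lookup_symbol_deriv:
  "Poly_Mapping.lookup (symbol_deriv i P) \<nu> = of_nat (count \<nu> i + 1) * Poly_Mapping.lookup P (add_mset i \<nu>)"
  unfolding symbol_deriv_def
  by (subst lookup_Abs_poly_mapping) (rule finite_lookup_add_mset, rule refl)

lemma symbol_deriv_add: "symbol_deriv i (P + Q) = symbol_deriv i P + symbol_deriv i Q"
  by (auto intro!: poly_mapping_eqI simp: lookup_symbol_deriv lookup_add algebra_simps)

lemma symbol_deriv_cmul: "symbol_deriv i (cmul c P) = cmul c (symbol_deriv i P)"
  by (auto intro!: poly_mapping_eqI simp: lookup_symbol_deriv algebra_simps)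

lemma symbol_deriv_zero [simp]: "symbol_deriv i 0 = 0"
  by (auto intro!: poly_mapping_eqI simp: lookup_symbol_deriv)

text \<open>Euler's identity: multiplying by \<xi>_l, then differentiating with respect to \<xi>_l,
  and summing over l gives the factor k + n in degree k.\<close>

lemma sum_count_Suc:
  fixes \<mu> :: "'n::finite multiset"
  shows "(\<Sum>l\<in>UNIV. of_nat (count \<mu> l + 1)) = (of_nat (size \<mu> + CARD('n)) :: 'k::field_char_0)"
proof -
  have "(\<Sum>l\<in>UNIV. count \<mu> l) = size \<mu>"
    unfolding size_multiset_overloaded_eq
    by (rule sum.mono_neutral_right) (auto simp: not_in_iff)
  then have "(\<Sum>l\<in>UNIV. count \<mu> l + 1) = size \<mu> + CARD('n)"
    by (simp only: sum.distrib) simp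
  then show ?thesis
    by (simp only: flip: of_nat_sum)
qed

context dmodule
begin

text \<open>The connection on $\mathrm{Hom}_K(V, D)$ induced by those of $V$ and $D$; its horizontal
  sections are the $D$-linear maps.\<close>

definition nabla :: "'n \<Rightarrow> ('v \<Rightarrow> ('n, 'k) dop) \<Rightarrow> 'v \<Rightarrow> ('n, 'k) dop" where
  "nabla i x v = dvar_mul pd i (x v) - x (act i v)"

text \<open>Maps that vanish on \<open>R\<close> stand for Hom_K(V/R, D). The order is strictly
  below \<open>k\<close>, so that \<open>k = 0\<close> leaves only the zero map and serves as the
  base of the inductions.\<close>

definition hom_order :: "'v set \<Rightarrow> nat \<Rightarrow> ('v \<Rightarrow> ('n, 'k) dop) \<Rightarrow> bool" where
  "hom_order R k x \<longleftrightarrow> Vector_Spaces.linear scale cmul x \<and> (\<forall>v\<in>R. x v = 0) \<and>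
     (\<forall>v \<mu>. k \<le> size \<mu> \<longrightarrow> Poly_Mapping.lookup (x v) \<mu> = 0)"

lemma linear_nabla:
  assumes "Vector_Spaces.linear scale cmul x"
  shows "Vector_Spaces.linear scale cmul (nabla i x)"
  by (rule linearI)
    (simp_all add: vector_space_axioms vector_space_cmul nabla_def linear_rules[OF assms] act_add act_scale
      D.act_add D.act_scale D.scale_right_diff_distrib)

lemma nabla_commute: "nabla i (nabla j x) = nabla j (nabla i x)"
  by (simp add: fun_eq_iff nabla_def D.act_diff D.act_commute act_commute)

lemma nabla_diff: "nabla i (\<lambda>v. x v - y v) = (\<lambda>v. nabla i x v - nabla i y v)"
  by (simp add: fun_eq_iff nabla_def D.act_diff)

lemma nabla_add: "nabla i (\<lambda>v. x v + y v) = (\<lambda>v. nabla i x v + nabla i y v)"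
  by (simp add: fun_eq_iff nabla_def D.act_add)

lemma linear_minus_fun:
  assumes "Vector_Spaces.linear scale cmul x" "Vector_Spaces.linear scale cmul y"
  shows "Vector_Spaces.linear scale (cmul :: 'k \<Rightarrow> ('n, 'k) dop \<Rightarrow> _) (\<lambda>v. x v - y v)"
  by (rule linearI)
    (simp_all add: vector_space_axioms vector_space_cmul linear_rules[OF assms(1)] linear_rules[OF assms(2)]
      D.scale_right_diff_distrib)

lemma hom_order_diff: "hom_order R k x \<Longrightarrow> hom_order R k y \<Longrightarrow> hom_order R k (\<lambda>v. x v - y v)"
  by (auto simp: hom_order_def linear_minus_fun lookup_minus)

lemma hom_order_add:
  assumes "hom_order R k x" "hom_order R k y"
  shows "hom_order R k (\<lambda>v. x v + y v)"
proof -
  have "hom_order R k (\<lambda>v. 0)"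
    by (auto simp: hom_order_def intro!: linearI vector_space_axioms vector_space_cmul)
  then have "hom_order R k (\<lambda>v. x v - (0 - y v))"
    by (intro hom_order_diff assms)
  then show ?thesis by simp
qed

lemma hom_order_mono: "hom_order R k x \<Longrightarrow> k \<le> l \<Longrightarrow> hom_order R l x"
  by (auto simp: hom_order_def)

text \<open>The derivatives of the coefficients and the term \<open>x (act i v)\<close> have order
  below \<open>k\<close>; from degree \<open>k\<close> on, only the shift of the monomial by
  \<open>d_i\<close> remains.\<close>

lemma nabla_top:
  assumes "hom_order R k x" "k \<le> size \<mu>"
  shows "Poly_Mapping.lookup (nabla i x v) \<mu>
    = (if i \<in># \<mu> then Poly_Mapping.lookup (x v) (\<mu> - {#i#}) else 0)"
  using assms by (simp add: hom_order_def nabla_def lookup_minus lookup_dvar_mul)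

lemma hom_order_nabla:
  assumes "hom_order R k x" "\<And>i r. r \<in> R \<Longrightarrow> act i r \<in> R"
  shows "hom_order R (Suc k) (nabla i x)"
  unfolding hom_order_def
proof (intro conjI ballI allI impI)
  show "Vector_Spaces.linear scale cmul (nabla i x)"
    using assms by (intro linear_nabla) (simp add: hom_order_def)
  show "nabla i x v = 0" if "v \<in> R" for v
    using assms that by (simp add: hom_order_def nabla_def)
  show "Poly_Mapping.lookup (nabla i x v) \<mu> = 0" if "Suc k \<le> size \<mu>" for v \<mu>
  proof -
    have "k \<le> size (\<mu> - {#i#})"
      using that by (auto simp: size_Diff_singleton_if)
    then show ?thesis
      using assms(1) that by (subst nabla_top[OF assms(1)]) (auto simp: hom_order_def)
  qed
qed

lemma hom_order_SucD:
  assumes "hom_order R (Suc k) x" "\<And>v \<mu>. size \<mu> = k \<Longrightarrow> Poly_Mapping.lookup (x v) \<mu> = 0"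
  shows "hom_order R k x"
  using assms unfolding hom_order_def by (metis le_antisym not_less_eq_eq)

lemma hom_order_zero: "hom_order R 0 x \<Longrightarrow> x v = 0"
  by (auto intro!: poly_mapping_eqI simp: hom_order_def)

lemma hom_order_symbol_deriv:
  assumes "\<And>l. hom_order R (Suc k) (h l)"
  shows "hom_order R k (\<lambda>v. cmul c (\<Sum>l\<in>UNIV. symbol_deriv l (h l v)))"
  unfolding hom_order_def
proof (intro conjI ballI allI impI)
  have lin: "Vector_Spaces.linear scale cmul (h l)" for l
    using assms by (simp add: hom_order_def)
  show "Vector_Spaces.linear scale cmul (\<lambda>v. cmul c (\<Sum>l\<in>UNIV. symbol_deriv l (h l v)))"
    by (rule linearI)
      (simp_all add: vector_space_axioms vector_space_cmul linear_rules[OF lin] symbol_deriv_add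
        symbol_deriv_cmul sum.distrib D.scale_right_distrib D.scale_sum_right mult.commute)
qed (use assms in \<open>auto simp: hom_order_def lookup_sum lookup_symbol_deriv\<close>)

text \<open>
  Both \<open>nabla_exact\<close> lemmas remove the top symbol of a cocycle: there the connection acts by
  multiplication by $\xi_i$, and the Koszul complex is contracted by
  $\frac1{k+n-p}\sum_l \iota_l\,\partial/\partial\xi_l$ on $p$-forms with coefficients of degree $k$.
\<close>

lemma nabla_exact_1:
  assumes "2 \<le> CARD('n)" and R: "\<And>i r. r \<in> R \<Longrightarrow> act i r \<in> R"
    and "\<And>i. hom_order R k (h i)" "\<And>i j. nabla i (h j) = nabla j (h i)"
  shows "\<exists>y k. hom_order R k y \<and> (\<forall>i. h i = nabla i y)"
  using assms(3,4)
proof (induction k arbitrary: h)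
  case 0
  have "h i = (\<lambda>v. 0)" for i
    using hom_order_zero[OF "0.prems"(1)] by (simp add: fun_eq_iff)
  moreover have "hom_order R 0 (\<lambda>v. 0)"
    by (auto simp: hom_order_def intro!: linearI vector_space_axioms vector_space_cmul)
  moreover have "nabla i (\<lambda>v. 0) = (\<lambda>v. 0)" for i
    by (simp add: fun_eq_iff nabla_def)
  ultimately show ?case by (intro exI[of _ "\<lambda>v. 0"] exI[of _ 0]) auto
next
  case (Suc k)
  \<comment> \<open>Order below \<open>Suc k\<close> means top degree \<open>k\<close>, so this is
    the constant of the homotopy for p = 1.\<close>
  define c :: 'k where "c = 1 / of_nat (k + CARD('n) - 1)"
  define y where "y = (\<lambda>v. cmul c (\<Sum>l\<in>UNIV. symbol_deriv l (h l v)))"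
  have y: "hom_order R k y"
    unfolding y_def by (intro hom_order_symbol_deriv Suc.prems)
  define h' where "h' = (\<lambda>i v. h i v - nabla i y v)"
  have top: "Poly_Mapping.lookup (nabla i y v) \<mu> = Poly_Mapping.lookup (h i v) \<mu>" if "size \<mu> = k" for i v \<mu>
  proof -
    \<comment> \<open>Closedness read on top symbols: \<xi>_i h_l = \<xi>_l h_i, compared at the
      monomial \<mu> times \<xi>_l.\<close>
    have rel: "(if i \<in># add_mset l \<mu> then Poly_Mapping.lookup (h l v) (add_mset l \<mu> - {#i#}) else 0)
        = Poly_Mapping.lookup (h i v) \<mu>" for l
      using nabla_top[OF Suc.prems(1)[of l], of "add_mset l \<mu>" i v]
        nabla_top[OF Suc.prems(1)[of i], of "add_mset l \<mu>" l v] Suc.prems(2)[of i l] that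
      by simp
    \<comment> \<open>The product rule: with D_l the derivative by \<xi>_l, \<xi>_i D_l h_l is
      D_l(\<xi>_i h_l) minus h_i if l = i, and \<xi>_i h_l may be replaced by \<xi>_l h_i.\<close>
    have "(if i \<in># \<mu> then Poly_Mapping.lookup (symbol_deriv l (h l v)) (\<mu> - {#i#}) else 0)
        = (of_nat (count \<mu> l + 1) - (if l = i then 1 else 0)) * Poly_Mapping.lookup (h i v) \<mu>" for l
    proof (cases "i \<in># \<mu>")
      case True
      then have "add_mset l (\<mu> - {#i#}) = add_mset l \<mu> - {#i#}" by simp
      moreover have "count (\<mu> - {#i#}) l + 1 = count \<mu> l" if "l = i"
        using True that by simp
      ultimately show ?thesis
        using True rel[of l] by (auto simp: lookup_symbol_deriv of_nat_diff)
    next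
      case False
      then show ?thesis
        using rel[of l] by (auto simp: count_eq_zero_iff[THEN iffD2, OF False])
    qed
    then have "Poly_Mapping.lookup (nabla i y v) \<mu>
        = c * (\<Sum>l\<in>UNIV. (of_nat (count \<mu> l + 1) - (if l = i then 1 else 0)) * Poly_Mapping.lookup (h i v) \<mu>)"
      using that by (subst nabla_top[OF y]) (auto simp: y_def lookup_sum if_distrib cong: if_cong)
    also have "(\<Sum>l\<in>UNIV. (of_nat (count \<mu> l + 1) - (if l = i then 1 else 0)) * Poly_Mapping.lookup (h i v) \<mu>)
        = (of_nat (k + CARD('n)) - 1) * Poly_Mapping.lookup (h i v) \<mu>"
      using that by (simp only: sum_count_Suc sum_subtractf flip: sum_distrib_right) simp
    also have "(of_nat (k + CARD('n)) - 1 :: 'k) = of_nat (k + CARD('n) - 1)"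
      using assms(1) by (subst of_nat_diff) auto
    also have "c * (of_nat (k + CARD('n) - 1) * Poly_Mapping.lookup (h i v) \<mu>) = Poly_Mapping.lookup (h i v) \<mu>"
      using assms(1) by (simp add: c_def flip: of_nat_add del: of_nat_diff)
    finally show ?thesis .
  qed
  have "\<exists>y k. hom_order R k y \<and> (\<forall>i. h' i = nabla i y)"
  proof (rule Suc.IH)
    show "hom_order R k (h' i)" for i
    proof (rule hom_order_SucD)
      show "hom_order R (Suc k) (h' i)"
        unfolding h'_def by (intro hom_order_diff Suc.prems hom_order_nabla y R)
    qed (simp add: h'_def lookup_minus top)
    show "nabla i (h' j) = nabla j (h' i)" for i j
      unfolding h'_def nabla_diff using Suc.prems(2)[of i j]
      by (simp add: nabla_commute[of i j y])
  qed
  then obtain y' k' where y': "hom_order R k' y'" "\<And>i. h' i = nabla i y'" by blast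
  have "hom_order R (max k k') (\<lambda>v. y v + y' v)"
    by (intro hom_order_add hom_order_mono[OF y] hom_order_mono[OF y'(1)]) auto
  moreover have "h i = nabla i (\<lambda>v. y v + y' v)" for i
    by (simp add: nabla_add h'_def fun_eq_iff flip: y'(2))
  ultimately show ?case by blast
qed

lemma nabla_exact_2:
  assumes "3 \<le> CARD('n)" and R: "\<And>i r. r \<in> R \<Longrightarrow> act i r \<in> R"
    and "\<And>i j. hom_order R k (h i j)" "\<And>i j v. h i j v = - h j i v"
    and "\<And>i j l v. nabla l (h i j) v + nabla i (h j l) v + nabla j (h l i) v = 0"
  shows "\<exists>y k. (\<forall>i. hom_order R k (y i)) \<and> (\<forall>i j v. h i j v = nabla i (y j) v - nabla j (y i) v)"
  using assms(3-5)
proof (induction k arbitrary: h)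
  case 0
  have "h i j = (\<lambda>v. 0)" for i j
    using hom_order_zero[OF "0.prems"(1)] by (simp add: fun_eq_iff)
  moreover have "hom_order R 0 (\<lambda>v. 0)"
    by (auto simp: hom_order_def intro!: linearI vector_space_axioms vector_space_cmul)
  moreover have "nabla i (\<lambda>v. 0) = (\<lambda>v. 0)" for i
    by (simp add: fun_eq_iff nabla_def)
  ultimately show ?case by (intro exI[of _ "\<lambda>i v. 0"] exI[of _ 0]) auto
next
  case (Suc k)
  define c :: 'k where "c = 1 / of_nat (k + CARD('n) - 2)"
  define y where "y = (\<lambda>j v. cmul c (\<Sum>l\<in>UNIV. symbol_deriv l (h l j v)))"
  have y: "hom_order R k (y j)" for j
    unfolding y_def by (intro hom_order_symbol_deriv Suc.prems)
  define h' where "h' = (\<lambda>i j v. h i j v - (nabla i (y j) v - nabla j (y i) v))"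
  have hii: "h i i v = 0" for i v
  proof -
    have "cmul 2 (h i i v) = 0"
      using Suc.prems(2)[of i i v] D.scale_left_distrib[of 1 1 "h i i v"]
      by (simp add: eq_neg_iff_add_eq_0)
    then show ?thesis by (metis D.scale_eq_0_iff zero_neq_numeral)
  qed
  have top: "Poly_Mapping.lookup (nabla i (y j) v - nabla j (y i) v) \<mu> = Poly_Mapping.lookup (h i j v) \<mu>"
    if \<mu>: "size \<mu> = k" and "i \<noteq> j" for i j v \<mu>
  proof -
    let ?L = "Poly_Mapping.lookup"
    have anti: "?L (h j i v) \<nu> = - ?L (h i j v) \<nu>" for \<nu> i j
      by (subst Suc.prems(2)) (rule lookup_uminus)
    \<comment> \<open>The closed 2-form on symbols: \<xi>_i h_lj - \<xi>_j h_li = \<xi>_l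
      h_ij.\<close>
    have rel: "(if i \<in># add_mset l \<mu> then ?L (h l j v) (add_mset l \<mu> - {#i#}) else 0)
        - (if j \<in># add_mset l \<mu> then ?L (h l i v) (add_mset l \<mu> - {#j#}) else 0)
        = ?L (h i j v) \<mu>" for l
    proof -
      have "?L (nabla l (h i j) v) (add_mset l \<mu>) + ?L (nabla i (h j l) v) (add_mset l \<mu>)
          + ?L (nabla j (h l i) v) (add_mset l \<mu>) = 0"
        using Suc.prems(3)[of l i j v] by (simp flip: lookup_add)
      then have "?L (h i j v) \<mu> + (if i \<in># add_mset l \<mu> then ?L (h j l v) (add_mset l \<mu> - {#i#}) else 0)
          + (if j \<in># add_mset l \<mu> then ?L (h l i v) (add_mset l \<mu> - {#j#}) else 0) = 0"
        using \<mu> by (simp add: nabla_top[OF Suc.prems(1)])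
      moreover have "(if i \<in># add_mset l \<mu> then ?L (h l j v) (add_mset l \<mu> - {#i#}) else 0)
          = - (if i \<in># add_mset l \<mu> then ?L (h j l v) (add_mset l \<mu> - {#i#}) else 0)"
        by (simp add: anti[of l j])
      ultimately show ?thesis by algebra
    qed
    \<comment> \<open>The product rule again; now both l = i and l = j contribute a correction,
      which accounts for the 2 in k + n - 2.\<close>
    have single: "(if i \<in># \<mu> then ?L (symbol_deriv l (h l j v)) (\<mu> - {#i#}) else 0)
        - (if j \<in># \<mu> then ?L (symbol_deriv l (h l i v)) (\<mu> - {#j#}) else 0)
        = (of_nat (count \<mu> l + 1) - (if l = i then 1 else 0) - (if l = j then 1 else 0)) * ?L (h i j v) \<mu>" for l
    proof -
      consider "l = i" | "l = j" | "l \<noteq> i" "l \<noteq> j" by blast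
      then show ?thesis
      proof cases
        case 1
        have "of_nat (count (\<mu> - {#i#}) i + 1) = (of_nat (count \<mu> i) :: 'k)" if "i \<in># \<mu>"
          using that by simp
        then show ?thesis
          using 1 \<open>i \<noteq> j\<close> by (auto simp: lookup_symbol_deriv hii not_in_iff simp del: count_diff)
      next
        case 2
        have "of_nat (count (\<mu> - {#j#}) j + 1) = (of_nat (count \<mu> j) :: 'k)" if "j \<in># \<mu>"
          using that by simp
        then show ?thesis
          using 2 \<open>i \<noteq> j\<close>
          by (auto simp: lookup_symbol_deriv hii not_in_iff anti[of j i] simp del: count_diff)
      next
        case 3
        have "(if i \<in># \<mu> then ?L (symbol_deriv l (h l j v)) (\<mu> - {#i#}) else 0)
          = of_nat (count \<mu> l + 1) * (if i \<in># add_mset l \<mu> then ?L (h l j v) (add_mset l \<mu> - {#i#}) else 0)"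
          and "(if j \<in># \<mu> then ?L (symbol_deriv l (h l i v)) (\<mu> - {#j#}) else 0)
          = of_nat (count \<mu> l + 1) * (if j \<in># add_mset l \<mu> then ?L (h l i v) (add_mset l \<mu> - {#j#}) else 0)"
          using 3 by (auto simp: lookup_symbol_deriv)
        then show ?thesis
          using 3 rel[of l] by (simp only: flip: right_diff_distrib) simp
      qed
    qed
    have "?L (nabla i (y j) v - nabla j (y i) v) \<mu>
        = c * (\<Sum>l\<in>UNIV. (if i \<in># \<mu> then ?L (symbol_deriv l (h l j v)) (\<mu> - {#i#}) else 0)
            - (if j \<in># \<mu> then ?L (symbol_deriv l (h l i v)) (\<mu> - {#j#}) else 0))"
      using \<mu> by (simp add: lookup_minus nabla_top[OF y] sum_subtractf right_diff_distrib)
        (auto simp: y_def lookup_sum)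
    also have "\<dots> = c * ((of_nat (k + CARD('n)) - 1 - 1) * ?L (h i j v) \<mu>)"
      using \<mu> by (simp only: single sum_count_Suc sum_subtractf flip: sum_distrib_right) simp
    also have "(of_nat (k + CARD('n)) - 1 - 1 :: 'k) = of_nat (k + CARD('n) - 2)"
      using assms(1) by (subst of_nat_diff) auto
    also have "c * (of_nat (k + CARD('n) - 2) * ?L (h i j v) \<mu>) = ?L (h i j v) \<mu>"
    proof -
      have "of_nat (k + CARD('n) - 2) \<noteq> (0 :: 'k)"
        using assms(1) by (simp only: of_nat_eq_0_iff)
      then show ?thesis by (simp add: c_def del: of_nat_diff)
    qed
    finally show ?thesis .
  qed
  have "\<exists>y k. (\<forall>i. hom_order R k (y i)) \<and> (\<forall>i j v. h' i j v = nabla i (y j) v - nabla j (y i) v)"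
  proof (rule Suc.IH)
    show "hom_order R k (h' i j)" for i j
    proof (rule hom_order_SucD)
      show "hom_order R (Suc k) (h' i j)"
        unfolding h'_def by (intro hom_order_diff Suc.prems hom_order_nabla y R)
      show "Poly_Mapping.lookup (h' i j v) \<mu> = 0" if "size \<mu> = k" for v \<mu>
        using top[OF that, of i j v] by (cases "i = j") (simp_all add: h'_def lookup_minus hii)
    qed
    show "h' i j v = - h' j i v" for i j v
      using Suc.prems(2)[of i j v] by (simp add: h'_def)
    show "nabla l (h' i j) v + nabla i (h' j l) v + nabla j (h' l i) v = 0" for i j l v
      unfolding h'_def nabla_diff using Suc.prems(3)[of l i j v]
      by (simp add: nabla_commute[of i j] nabla_commute[of j l] nabla_commute[of i l] add.assoc)
  qed
  then obtain y' k' where y': "\<And>i. hom_order R k' (y' i)"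
    "\<And>i j v. h' i j v = nabla i (y' j) v - nabla j (y' i) v" by blast
  have A: "hom_order R (max k k') (\<lambda>v. y i v + y' i v)" for i
    by (intro hom_order_add hom_order_mono[OF y] hom_order_mono[OF y'(1)]) auto
  have B: "h i j v = nabla i (\<lambda>v. y j v + y' j v) v - nabla j (\<lambda>v. y i v + y' i v) v" for i j v
    using y'(2)[of i j v] by (simp add: nabla_add h'_def algebra_simps)
  show ?case
    by (intro exI[of _ "\<lambda>i v. y i v + y' i v"] exI[of _ "max k k'"] conjI allI) (rule A, rule B)
qed

text \<open>K-linear combinations do not enlarge supports, so the orders on a finite set spanning
  modulo \<open>R\<close> bound all orders. This is where finite dimension of M enters.\<close>

lemma hom_order_exists:
  assumes B: "finite B" "\<And>v. \<exists>u\<in>span B. v - u \<in> R"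
    and x: "Vector_Spaces.linear scale cmul x" "\<And>v. v \<in> R \<Longrightarrow> x v = 0"
  shows "\<exists>k. hom_order R k x"
proof -
  \<comment> \<open>The inserted 0 keeps \<open>Max\<close> meaningful when all \<open>x b\<close>
    vanish; \<open>Suc\<close> makes the bound strict.\<close>
  define k where "k = Suc (Max (insert 0 (size ` (\<Union>b\<in>B. Poly_Mapping.keys (x b)))))"
  have k: "Poly_Mapping.lookup (x b) \<mu> = 0" if "b \<in> B" "k \<le> size \<mu>" for b \<mu>
  proof (rule ccontr)
    assume "Poly_Mapping.lookup (x b) \<mu> \<noteq> 0"
    then have "\<mu> \<in> (\<Union>b\<in>B. Poly_Mapping.keys (x b))"
      using that by (auto simp: in_keys_iff)
    then have "size \<mu> < k"
      unfolding k_def less_Suc_eq_le by (intro Max_ge) (use B(1) in auto)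
    then show False using that by simp
  qed
  have span: "Poly_Mapping.lookup (x u) \<mu> = 0" if "u \<in> span B" "k \<le> size \<mu>" for u \<mu>
    using that(1)
    by (induction rule: span_induct_alt) (simp_all add: linear_rules[OF x(1)] lookup_add k that(2))
  have "Poly_Mapping.lookup (x v) \<mu> = 0" if "k \<le> size \<mu>" for v \<mu>
  proof -
    obtain u where u: "u \<in> span B" "v - u \<in> R" using B(2) by blast
    then have "x v = x u"
      using x(2)[OF u(2)] by (simp add: linear_rules[OF x(1)])
    then show ?thesis using span u that by simp
  qed
  then show ?thesis using x by (auto simp: hom_order_def)
qed

lemma hom_order_uniform:
  assumes "finite I" "\<And>i. i \<in> I \<Longrightarrow> \<exists>k. hom_order R k (h i)"
  shows "\<exists>k. \<forall>i\<in>I. hom_order R k (h i)"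
proof -
  obtain k where k: "\<And>i. i \<in> I \<Longrightarrow> hom_order R (k i) (h i)"
    using assms(2) by metis
  have "hom_order R (Max (k ` I)) (h i)" if "i \<in> I" for i
    using assms(1) that by (intro hom_order_mono[OF k]) auto
  then show ?thesis by blast
qed

end

section \<open>Extending D-linear forms along a map with finite-dimensional cokernel\<close>

definition dlinear where
  "dlinear s a t b f \<longleftrightarrow> Vector_Spaces.linear s t f \<and> (\<forall>i x. f (a i x) = b i (f x))"

locale finite_cokernel = V: dmodule pd s a + W: dmodule pd t b
  for pd :: "'n::finite \<Rightarrow> 'k::field_char_0 \<Rightarrow> 'k"
    and s :: "'k \<Rightarrow> 'v::ab_group_add \<Rightarrow> 'v" and a
    and t :: "'k \<Rightarrow> 'w::ab_group_add \<Rightarrow> 'w" and b +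
  fixes \<phi> :: "'w \<Rightarrow> 'v" and \<sigma> :: "'v \<Rightarrow> 'w" and R B :: "'v set"
  assumes phi: "dlinear t b s a \<phi>" and sigma: "Vector_Spaces.linear s t \<sigma>"
    and phi_sigma: "\<phi> (\<sigma> (\<phi> x)) = \<phi> x"
    and R_subspace: "V.subspace R" and R_act: "r \<in> R \<Longrightarrow> a i r \<in> R"
    and range_R: "\<phi> x \<in> R"
    and sigma_act: "r \<in> R \<Longrightarrow> \<phi> (b i (\<sigma> r)) = \<phi> (\<sigma> (a i r))"
    and finite_B: "finite B" and span_B: "\<exists>u\<in>V.span B. v - u \<in> R"
begin

lemma phi_linear: "Vector_Spaces.linear t s \<phi>" and phi_act: "\<phi> (b i x) = a i (\<phi> x)"
  using phi by (simp_all add: dlinear_def)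

lemmas phi_rules = linear_rules[OF phi_linear]
lemmas sigma_rules = linear_rules[OF sigma]

text \<open>The form induced by \<open>f\<close> on the image has the K-linear extension
  \<open>f \<circ> \<sigma>\<close>. Its \<open>nabla\<close> is closed and vanishes on
  \<open>R\<close>, hence has a primitive \<open>y\<close> that also vanishes on \<open>R\<close>;
  subtracting \<open>y\<close> restores D-linearity without changing the values on the
  image.\<close>

lemma extend_from_image:
  assumes n: "2 \<le> CARD('n)"
    and f: "dlinear t b cmul (dvar_mul pd) f" "\<And>x. \<phi> x = 0 \<Longrightarrow> f x = 0"
  shows "\<exists>g. dlinear s a cmul (dvar_mul pd) g \<and> (\<forall>x. g (\<phi> x) = f x)"
proof -
  have fl: "Vector_Spaces.linear t cmul f" and fd: "\<And>i x. f (b i x) = dvar_mul pd i (f x)"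
    using f(1) by (simp_all add: dlinear_def)
  note fr = linear_rules[OF fl]
  have f_eq: "f x = f y" if "\<phi> x = \<phi> y" for x y
    using f(2)[of "x - y"] that by (simp add: phi_rules fr)
  define f0 where "f0 = (\<lambda>v. f (\<sigma> v))"
  have f0: "Vector_Spaces.linear s cmul f0"
    by (rule linearI)
      (simp_all add: V.vector_space_axioms vector_space_cmul f0_def sigma_rules fr)
  have "V.nabla i f0 r = 0" if "r \<in> R" for i r
    using f_eq[OF sigma_act[OF that, of i]] by (simp add: V.nabla_def f0_def fd)
  then have "\<exists>k. V.hom_order R k (V.nabla i f0)" for i
    by (intro V.hom_order_exists[OF finite_B span_B] V.linear_nabla f0)
  then have "\<exists>k. \<forall>i\<in>UNIV. V.hom_order R k (V.nabla i f0)"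
    by (intro V.hom_order_uniform) auto
  then obtain k where "\<And>i. V.hom_order R k (V.nabla i f0)" by blast
  from V.nabla_exact_1[OF n R_act this V.nabla_commute]
  obtain y l where y: "V.hom_order R l y" "\<And>i. V.nabla i f0 = V.nabla i y" by blast
  define g where "g = (\<lambda>v. f0 v - y v)"
  have "Vector_Spaces.linear s cmul g"
    using y(1) unfolding g_def by (intro V.linear_minus_fun f0) (simp add: V.hom_order_def)
  moreover have "g (a i v) = dvar_mul pd i (g v)" for i v
  proof -
    have "V.nabla i g v = 0"
      using y(2)[of i] by (simp add: g_def V.nabla_diff)
    then show ?thesis by (simp add: V.nabla_def)
  qed
  moreover have "g (\<phi> x) = f x" for x
    using y(1) range_R f_eq[OF phi_sigma] by (simp add: g_def f0_def V.hom_order_def)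
  ultimately show ?thesis by (auto simp: dlinear_def)
qed

text \<open>Vanishing of ext^2 by dimension shift. The hypothesis \<open>free\<close> is the
  splitting of closed 1-forms on \<open>V\<close>, needed only on the image of
  \<open>\<phi>\<close>.\<close>

lemma extend_from_kernel:
  assumes n: "3 \<le> CARD('n)"
    and f: "Vector_Spaces.linear t cmul f" "\<And>i x. \<phi> x = 0 \<Longrightarrow> f (b i x) = dvar_mul pd i (f x)"
    and free: "\<And>\<gamma>. (\<And>i. Vector_Spaces.linear s cmul (\<gamma> i)) \<Longrightarrow>
      (\<And>i j. V.nabla i (\<gamma> j) = V.nabla j (\<gamma> i)) \<Longrightarrow>
      \<exists>\<tau>. Vector_Spaces.linear s cmul \<tau> \<and> (\<forall>i x. \<tau> (a i (\<phi> x)) = dvar_mul pd i (\<tau> (\<phi> x)) + \<gamma> i (\<phi> x))"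
  shows "\<exists>g. dlinear t b cmul (dvar_mul pd) g \<and> (\<forall>x. \<phi> x = 0 \<longrightarrow> g x = f x)"
proof -
  note fr = linear_rules[OF f(1)]
  interpret VV: vector_space_pair s s ..
  have id: "Vector_Spaces.linear s s (\<lambda>v. v)"
    by (rule linearI) (simp_all add: V.vector_space_axioms)
  \<comment> \<open>A right inverse on \<open>R\<close> of the identity is a K-linear projection
    onto \<open>R\<close>; composing with it extends a form from \<open>R\<close> to all of
    \<open>V\<close>.\<close>
  from VV.linear_exists_right_inverse_on[OF id R_subspace]
  obtain p where p: "\<And>v. p v \<in> R" "Vector_Spaces.linear s s p" "\<And>r. r \<in> R \<Longrightarrow> p r = r"
    by auto
  note pr = linear_rules[OF p(2)]
  \<comment> \<open>The failure of \<open>\<sigma>\<close> to be D-linear. For \<open>r\<close> in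
    \<open>R\<close> the argument of \<open>f\<close> lies in the kernel of \<open>\<phi>\<close>,
    where \<open>f\<close> is D-linear.\<close>
  define \<gamma>0 where "\<gamma>0 = (\<lambda>i r. f (b i (\<sigma> r) - \<sigma> (a i r)))"
  have \<gamma>0: "Vector_Spaces.linear s cmul (\<gamma>0 i)" for i
    by (rule linearI)
      (simp_all add: V.vector_space_axioms vector_space_cmul \<gamma>0_def sigma_rules fr W.act_add V.act_add
        V.act_scale W.act_scale V.D.scale_right_diff_distrib)
  define \<gamma> where "\<gamma> = (\<lambda>i v. \<gamma>0 i (p v))"
  have \<gamma>: "Vector_Spaces.linear s cmul (\<gamma> i)" for i
    by (rule linearI)
      (simp_all add: V.vector_space_axioms vector_space_cmul \<gamma>_def pr linear_rules[OF \<gamma>0])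
  define h where "h = (\<lambda>i j v. V.nabla i (\<gamma> j) v - V.nabla j (\<gamma> i) v)"
  have h_lin: "Vector_Spaces.linear s cmul (h i j)" for i j
    unfolding h_def by (intro V.linear_minus_fun V.linear_nabla \<gamma>)
  have h_R: "h i j r = 0" if r: "r \<in> R" for i j r
  proof -
    \<comment> \<open>The right-hand side is symmetric in \<open>i\<close> and \<open>j\<close>,
      which is closedness of \<open>\<gamma>0\<close> on \<open>R\<close>.\<close>
    have "dvar_mul pd i (\<gamma>0 j r) + \<gamma>0 i (a j r) = f (b i (b j (\<sigma> r)) - \<sigma> (a i (a j r)))" for i j
    proof -
      have "\<phi> (b j (\<sigma> r) - \<sigma> (a j r)) = 0"
        using sigma_act[OF r] by (simp add: phi_rules)
      from f(2)[OF this, of i] show ?thesis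
        by (simp add: \<gamma>0_def W.act_diff fr algebra_simps)
    qed
    from this[of i j] this[of j i] show ?thesis
      using r by (simp add: h_def V.nabla_def \<gamma>_def p R_act W.act_commute[of i j] V.act_commute[of i j]
          algebra_simps)
  qed
  have "\<exists>k. \<forall>ij\<in>UNIV. V.hom_order R k (h (fst ij) (snd ij))"
    by (intro V.hom_order_uniform V.hom_order_exists[OF finite_B span_B] h_lin h_R) auto
  then obtain k where k: "\<And>i j. V.hom_order R k (h i j)" by fastforce
  have anti: "h i j v = - h j i v" for i j v
    by (simp add: h_def)
  have closed: "V.nabla l (h i j) v + V.nabla i (h j l) v + V.nabla j (h l i) v = 0" for i j l v
    unfolding h_def V.nabla_diff
    by (simp add: V.nabla_commute[of i j] V.nabla_commute[of j l] V.nabla_commute[of i l])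
  have "\<exists>y l. (\<forall>i. V.hom_order R l (y i)) \<and> (\<forall>i j v. h i j v = V.nabla i (y j) v - V.nabla j (y i) v)"
    by (rule V.nabla_exact_2[OF n _ k anti closed]) (rule R_act)
  then obtain y l where y: "\<And>i. V.hom_order R l (y i)"
      "\<And>i j v. h i j v = V.nabla i (y j) v - V.nabla j (y i) v"
    by blast
  have "\<exists>\<tau>. Vector_Spaces.linear s cmul \<tau> \<and>
      (\<forall>i x. \<tau> (a i (\<phi> x)) = dvar_mul pd i (\<tau> (\<phi> x)) + (\<gamma> i (\<phi> x) - y i (\<phi> x)))"
  proof (rule free)
    show "Vector_Spaces.linear s cmul (\<lambda>x. \<gamma> i x - y i x)" for i
      using y(1)[of i] by (intro V.linear_minus_fun \<gamma>) (simp add: V.hom_order_def)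
    show "V.nabla i (\<lambda>x. \<gamma> j x - y j x) = V.nabla j (\<lambda>x. \<gamma> i x - y i x)" for i j
      using y(2)[of i j] by (simp add: V.nabla_diff fun_eq_iff h_def algebra_simps)
  qed
  then obtain \<tau> where \<tau>: "Vector_Spaces.linear s cmul \<tau>"
    "\<And>i x. \<tau> (a i (\<phi> x)) = dvar_mul pd i (\<tau> (\<phi> x)) + \<gamma>0 i (\<phi> x)"
    using y(1) range_R by (auto simp: \<gamma>_def p V.hom_order_def)
  note \<tau>r = linear_rules[OF \<tau>(1)]
  \<comment> \<open>\<open>x - \<sigma> (\<phi> x)\<close> is the K-linear projection to the kernel
    of \<open>\<phi>\<close>. Commuting the action past it costs
    \<open>\<gamma>0 i (\<phi> x)\<close>, which is exactly the defect of
    \<open>\<tau>\<close>.\<close>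
  define g where "g = (\<lambda>x. f (x - \<sigma> (\<phi> x)) - \<tau> (\<phi> x))"
  have "Vector_Spaces.linear t cmul g"
    by (rule linearI)
      (simp_all add: W.vector_space_axioms vector_space_cmul g_def fr phi_rules sigma_rules \<tau>r
        V.D.scale_right_diff_distrib)
  moreover have "g (b i x) = dvar_mul pd i (g x)" for i x
  proof -
    have "\<phi> (x - \<sigma> (\<phi> x)) = 0"
      by (simp add: phi_rules phi_sigma)
    from f(2)[OF this, of i]
    have "f (b i x) - f (b i (\<sigma> (\<phi> x))) = dvar_mul pd i (f (x - \<sigma> (\<phi> x)))"
      by (simp add: W.act_diff fr)
    then show ?thesis
      by (simp add: g_def phi_act \<tau>(2) V.D.act_diff V.D.act_add \<gamma>0_def fr algebra_simps)
  qed
  moreover have "g x = f x" if "\<phi> x = 0" for x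
    using that by (simp add: g_def sigma_rules \<tau>r)
  ultimately show ?thesis by (auto simp: dlinear_def)
qed

end

section \<open>Free modules\<close>

lemma dlinearI:
  assumes "vector_space s" "vector_space t"
    and "\<And>x y. f (x + y) = f x + f y" "\<And>c x. f (s c x) = t c (f x)" "\<And>i x. f (a i x) = b i (f x)"
  shows "dlinear s a t b f"
  using assms by (simp add: dlinear_def linearI)

lemma dlinear_linear: "dlinear s a t b f \<Longrightarrow> Vector_Spaces.linear s t f"
  and dlinear_act: "dlinear s a t b f \<Longrightarrow> f (a i x) = b i (f x)"
  by (simp_all add: dlinear_def)

lemma dlinear_app:
  assumes "dmodule pd s a" "dmodule pd t b" "dlinear s a t b f"
  shows "f (dmodule.app s a P x) = dmodule.app t b P (f x)"
proof -
  interpret V: dmodule pd s a by fact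
  interpret W: dmodule pd t b by fact
  note fr = linear_rules[OF dlinear_linear[OF assms(3)]]
  have "f (fold_mset a x \<mu>) = fold_mset b (f x) \<mu>" for \<mu>
    by (induction \<mu>) (simp_all add: dlinear_act[OF assms(3)])
  then show ?thesis
    by (simp add: V.app_def W.app_def fr)
qed

section \<open>Free modules inside spaces of total functions\<close>

definition fun_scale :: "'k::field_char_0 \<Rightarrow> ('j \<Rightarrow> ('n, 'k) dop) \<Rightarrow> ('j \<Rightarrow> ('n, 'k) dop)" where
  "fun_scale c x = (\<lambda>j. cmul c (x j))"

definition proj :: "'j set \<Rightarrow> ('j \<Rightarrow> ('n, 'k::field_char_0) dop) \<Rightarrow> ('j \<Rightarrow> ('n, 'k) dop)" where
  "proj J x = (\<lambda>j. if j \<in> J then x j else 0)"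

definition unit_vec :: "'j \<Rightarrow> 'j \<Rightarrow> ('n, 'k::field_char_0) dop" where
  "unit_vec j = (\<lambda>i. if i = j then Poly_Mapping.single {#} 1 else 0)"

lemma proj_in [simp]: "proj J x \<in> dvecs J"
  by (simp add: proj_def dvecs_def)

lemma proj_id: "x \<in> dvecs J \<Longrightarrow> proj J x = x"
  by (auto simp: proj_def dvecs_def)

lemma proj_add: "proj J (x + y) = proj J x + proj J y"
  by (auto simp: proj_def)

lemma dvecs_diff: "x \<in> dvecs J \<Longrightarrow> y \<in> dvecs J \<Longrightarrow> x - y \<in> dvecs J"
  and dvecs_zero: "0 \<in> dvecs J"
  by (simp_all add: dvecs_def)

lemma sum_fun_apply: "(sum f A) x = (\<Sum>a\<in>A. f a x)"
  by (induction A rule: infinite_finite_induct) simp_all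

lemma vector_space_fun_scale: "vector_space (fun_scale :: 'k::field_char_0 \<Rightarrow> ('j \<Rightarrow> ('n, 'k) dop) \<Rightarrow> _)"
proof -
  interpret vector_space "cmul :: 'k \<Rightarrow> ('n, 'k) dop \<Rightarrow> _" by (rule vector_space_cmul)
  show ?thesis
    by unfold_locales (simp_all add: fun_scale_def fun_eq_iff scale_right_distrib scale_left_distrib)
qed

context differential_field
begin

definition fun_act :: "'n \<Rightarrow> ('j \<Rightarrow> ('n, 'k) dop) \<Rightarrow> ('j \<Rightarrow> ('n, 'k) dop)" where
  "fun_act i x = (\<lambda>j. dvar_mul pd i (x j))"

lemma dmodule_fun: "dmodule pd fun_scale (fun_act :: 'n \<Rightarrow> ('j \<Rightarrow> ('n, 'k) dop) \<Rightarrow> _)"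
proof -
  interpret vector_space "fun_scale :: 'k \<Rightarrow> ('j \<Rightarrow> ('n, 'k) dop) \<Rightarrow> _" by (rule vector_space_fun_scale)
  show ?thesis
    by unfold_locales (simp_all add: fun_scale_def fun_act_def fun_eq_iff D.act_add D.act_scale D.act_commute)
qed

lemma proj_dlinear: "dlinear fun_scale fun_act fun_scale fun_act (proj J)"
  by (rule dlinearI) (auto simp: vector_space_fun_scale proj_def fun_scale_def fun_act_def fun_eq_iff)

lemma app_fun:
  fixes x :: "'j \<Rightarrow> ('n, 'k) dop"
  shows "dmodule.app fun_scale fun_act P x = (\<lambda>j. dmul pd P (x j))"
proof
  fix j
  have "dlinear fun_scale fun_act cmul (dvar_mul pd) (\<lambda>x :: 'j \<Rightarrow> ('n, 'k) dop. x j)"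
    by (rule dlinearI) (auto simp: vector_space_fun_scale vector_space_cmul fun_scale_def fun_act_def)
  from dlinear_app[OF dmodule_fun D.dmodule_axioms this]
  show "dmodule.app fun_scale fun_act P x j = dmul pd P (x j)"
    by (simp add: dmul_eq_app)
qed

lemma fun_expand:
  assumes "finite J" "x \<in> dvecs J"
  shows "x = (\<Sum>j\<in>J. dmodule.app fun_scale fun_act (x j) (unit_vec j))"
  using assms by (auto simp: fun_eq_iff sum_fun_apply app_fun unit_vec_def if_distrib[of "dmul pd _"] dvecs_def
      cong: if_cong)

lemma dlinear_dmul:
  assumes "dlinear fun_scale fun_act cmul (dvar_mul pd) g"
  shows "g (\<lambda>j. dmul pd P (x j)) = dmul pd P (g x)"
  using dlinear_app[OF dmodule_fun D.dmodule_axioms assms, of P x] by (simp add: app_fun dmul_eq_app)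

lemma dlinear_expand:
  assumes "dlinear fun_scale fun_act cmul (dvar_mul pd) g" "finite J" "x \<in> dvecs J"
  shows "g x = (\<Sum>j\<in>J. dmul pd (x j) (g (unit_vec j)))"
proof -
  have "g x = g (\<Sum>j\<in>J. dmodule.app fun_scale fun_act (x j) (unit_vec j))"
    using fun_expand[OF assms(2,3)] by simp
  also have "\<dots> = (\<Sum>j\<in>J. dmul pd (x j) (g (unit_vec j)))"
    by (simp add: linear_rules[OF dlinear_linear[OF assms(1)]] app_fun dlinear_dmul[OF assms(1)])
  finally show ?thesis .
qed

lemma row_mult_dlinear: "dlinear fun_scale fun_act fun_scale fun_act (\<lambda>x. row_mult pd I x A)"
  by (rule dlinearI)
    (simp_all add: vector_space_fun_scale row_mult_def fun_scale_def fun_act_def fun_eq_iff dmul_add_left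
      dmul_cmul_left dmul_dvar_mul_left sum.distrib D.scale_sum_right D.act_sum)

lemma row_mult_proj: "row_mult pd I (proj I x) A = row_mult pd I x A"
  by (simp add: row_mult_def proj_def)

lemma row_module_range: "row_module pd I A = range (\<lambda>x. row_mult pd I x A)"
  unfolding row_module_def proof (intro equalityI subsetI)
  show "y \<in> (\<lambda>x. row_mult pd I x A) ` dvecs I" if "y \<in> range (\<lambda>x. row_mult pd I x A)" for y
  proof -
    from that obtain x where "y = row_mult pd I x A" by auto
    then show ?thesis
      by (intro image_eqI[of _ _ "proj I x"]) (simp_all add: row_mult_proj)
  qed
qed auto

lemma row_module_subspace:
  fixes A :: "'i \<Rightarrow> 'j \<Rightarrow> ('n, 'k) dop"
  shows "module.subspace fun_scale (row_module pd I A)"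
proof -
  interpret F: dmodule pd fun_scale "fun_act :: 'n \<Rightarrow> ('j \<Rightarrow> ('n, 'k) dop) \<Rightarrow> _" by (rule dmodule_fun)
  note rules = linear_rules[OF dlinear_linear[OF row_mult_dlinear]]
  show ?thesis
    unfolding row_module_range
  proof (rule F.subspaceI)
    show "0 \<in> range (\<lambda>x. row_mult pd I x A)"
      by (rule range_eqI[of _ _ 0]) (simp add: rules)
  qed (auto simp flip: rules)
qed

lemma row_module_act: "x \<in> row_module pd I A \<Longrightarrow> fun_act i x \<in> row_module pd I A"
  by (auto simp: row_module_range simp flip: dlinear_act[OF row_mult_dlinear])

text \<open>$D^J$ has no first extensions by $D$: the extension with cocycle \<open>\<gamma>\<close> is split by lifting the
  standard basis.\<close>

lemma free_split:
  fixes \<gamma> :: "'n \<Rightarrow> ('j \<Rightarrow> ('n, 'k) dop) \<Rightarrow> ('n, 'k) dop"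
  assumes J: "finite J"
    and lin: "\<And>i. Vector_Spaces.linear fun_scale cmul (\<gamma> i)"
    and closed: "\<And>i j. dmodule.nabla pd fun_act i (\<gamma> j) = dmodule.nabla pd fun_act j (\<gamma> i)"
  shows "\<exists>\<tau>. Vector_Spaces.linear fun_scale cmul \<tau> \<and>
    (\<forall>i. \<forall>x\<in>dvecs J. \<tau> (fun_act i x) = dvar_mul pd i (\<tau> x) + \<gamma> i x)"
proof -
  interpret F: dmodule pd fun_scale "fun_act :: 'n \<Rightarrow> ('j \<Rightarrow> ('n, 'k) dop) \<Rightarrow> _" by (rule dmodule_fun)
  note lr = linear_rules[OF lin]
  \<comment> \<open>The extension with cocycle \<open>\<gamma>\<close>: a direct sum over K, with
    the action on the second component twisted by \<open>\<gamma>\<close>. The twisted operators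
    commute because \<open>\<gamma>\<close> is closed.\<close>
  define es :: "'k \<Rightarrow> ('j \<Rightarrow> ('n, 'k) dop) \<times> ('n, 'k) dop \<Rightarrow> _" where "es = (\<lambda>c (x, d). (fun_scale c x, cmul c d))"
  define ea :: "'n \<Rightarrow> ('j \<Rightarrow> ('n, 'k) dop) \<times> ('n, 'k) dop \<Rightarrow> _"
    where "ea = (\<lambda>i (x, d). (fun_act i x, dvar_mul pd i d + \<gamma> i x))"
  have comm: "dvar_mul pd i (\<gamma> j x) + \<gamma> i (fun_act j x) = dvar_mul pd j (\<gamma> i x) + \<gamma> j (fun_act i x)" for i j x
    using fun_cong[OF closed[of i j], of x] by (simp add: F.nabla_def algebra_simps)
  have vs: "vector_space es"
    unfolding vector_space_def
    by (auto simp: es_def F.scale_right_distrib F.scale_left_distrib D.scale_right_distrib D.scale_left_distrib)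
  interpret E: dmodule pd es ea
  proof (intro dmodule.intro vs dmodule_axioms.intro)
    show "differential_field pd" ..
    fix i j c and x y :: "('j \<Rightarrow> ('n, 'k) dop) \<times> ('n, 'k) dop"
    show "ea i (x + y) = ea i x + ea i y"
      by (auto simp: ea_def F.act_add D.act_add lr split: prod.splits)
    show "ea i (es c x) = es (pd i c) x + es c (ea i x)"
      by (auto simp: ea_def es_def F.act_scale D.act_scale lr D.scale_right_distrib split: prod.splits)
    show "ea i (ea j x) = ea j (ea i x)"
      using comm[of i j "fst x"]
      by (cases x) (simp add: ea_def F.act_commute[of i j] D.act_commute[of i j] D.act_add add.assoc)
  qed
  \<comment> \<open>\<open>S\<close> is the D-linear lift sending the basis vector of index
    \<open>j\<close> to \<open>(unit_vec j, 0)\<close>; it is a section of \<open>fst\<close> on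
    \<open>dvecs J\<close>, and its second component is the required \<open>\<tau>\<close>.\<close>
  define S where "S x = (\<Sum>j\<in>J. E.app (x j) (unit_vec j, 0))" for x
  have fst_dl: "dlinear es ea fun_scale fun_act fst"
    by (rule dlinearI[OF vs vector_space_fun_scale]) (auto simp: es_def ea_def split: prod.splits)
  have fst_S: "fst (S x) = x" if "x \<in> dvecs J" for x
    using fun_expand[OF J that]
    by (simp add: S_def linear_rules[OF dlinear_linear[OF fst_dl]]
        dlinear_app[OF E.dmodule_axioms F.dmodule_axioms fst_dl])
  have S_act: "S (fun_act i x) = ea i (S x)" for i x
    by (simp add: S_def fun_act_def E.app_dvar_mul E.act_sum)
  have "Vector_Spaces.linear fun_scale cmul (\<lambda>x. snd (S x))"
  proof (rule linearI)
    show "snd (S (x + y)) = snd (S x) + snd (S y)" for x y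
      by (simp add: S_def E.app_add_left sum.distrib)
    show "snd (S (fun_scale c x)) = cmul c (snd (S x))" for c x
    proof -
      have "S (fun_scale c x) = es c (S x)"
        by (simp add: S_def fun_scale_def E.app_cmul E.scale_sum_right)
      then show ?thesis by (simp add: es_def split: prod.splits)
    qed
  qed (simp_all add: vector_space_fun_scale vector_space_cmul)
  moreover have "snd (S (fun_act i x)) = dvar_mul pd i (snd (S x)) + \<gamma> i x" if "x \<in> dvecs J" for i x
    using fst_S[OF that] by (auto simp: S_act ea_def split: prod.splits)
  ultimately show ?thesis by blast
qed

text \<open>Passes from maps into \<open>dvecs J\<close> to the whole function type, using
  \<open>proj J\<close> to ignore the coordinates outside \<open>J\<close>.\<close>

lemma finite_cokernel_free:
  fixes \<phi> :: "('i \<Rightarrow> ('n, 'k) dop) \<Rightarrow> ('j \<Rightarrow> ('n, 'k) dop)"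
  assumes \<phi>: "dlinear fun_scale fun_act fun_scale fun_act \<phi>" and J: "range \<phi> \<subseteq> dvecs J"
    and B: "finite B" "\<And>v. v \<in> dvecs J \<Longrightarrow> \<exists>u\<in>module.span fun_scale B. v - u \<in> range \<phi>"
  shows "\<exists>\<sigma> R. finite_cokernel pd fun_scale fun_act fun_scale fun_act \<phi> \<sigma> R B"
proof -
  interpret V: dmodule pd fun_scale "fun_act :: 'n \<Rightarrow> ('j \<Rightarrow> ('n, 'k) dop) \<Rightarrow> _" by (rule dmodule_fun)
  interpret W: dmodule pd fun_scale "fun_act :: 'n \<Rightarrow> ('i \<Rightarrow> ('n, 'k) dop) \<Rightarrow> _" by (rule dmodule_fun)
  interpret P: vector_space_pair "fun_scale :: 'k \<Rightarrow> ('i \<Rightarrow> ('n, 'k) dop) \<Rightarrow> _"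
    "fun_scale :: 'k \<Rightarrow> ('j \<Rightarrow> ('n, 'k) dop) \<Rightarrow> _" ..
  note lin = dlinear_linear[OF \<phi>]
  note pl = linear_rules[OF dlinear_linear[OF proj_dlinear]]
  note lr = linear_rules[OF lin]
  obtain \<sigma>0 where \<sigma>0: "Vector_Spaces.linear fun_scale fun_scale \<sigma>0" "\<And>x. \<phi> (\<sigma>0 (\<phi> x)) = \<phi> x"
    using P.linear_exists_right_inverse_on[OF lin W.subspace_UNIV] by auto
  note sr = linear_rules[OF \<sigma>0(1)]
  \<comment> \<open>The full type modulo this \<open>R\<close> is D^J modulo the image of
    \<open>\<phi>\<close>; modulo the image alone it could be infinite-dimensional.\<close>
  define R where "R = {v. proj J v \<in> range \<phi>}"
  have proj\<phi>: "proj J (\<phi> x) = \<phi> x" for x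
    using J by (intro proj_id) auto
  show ?thesis
  proof (intro exI finite_cokernel.intro finite_cokernel_axioms.intro V.dmodule_axioms W.dmodule_axioms \<phi> B(1))
    show "Vector_Spaces.linear fun_scale fun_scale (\<lambda>v. \<sigma>0 (proj J v))"
      by (rule linearI) (simp_all add: vector_space_fun_scale pl sr)
    show "\<phi> (\<sigma>0 (proj J (\<phi> x))) = \<phi> x" for x
      by (simp add: proj\<phi> \<sigma>0)
    show "V.subspace R"
      by (rule V.subspaceI) (auto simp: R_def pl proj\<phi> simp flip: lr)
    show "fun_act i r \<in> R" if "r \<in> R" for r i
      using that by (auto simp: R_def dlinear_act[OF proj_dlinear] simp flip: dlinear_act[OF \<phi>])
    show "\<phi> x \<in> R" for x
      by (simp add: R_def proj\<phi>)
    show "\<phi> (fun_act i (\<sigma>0 (proj J r))) = \<phi> (\<sigma>0 (proj J (fun_act i r)))" if r: "r \<in> R" for r i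
    proof -
      obtain x where x: "proj J r = \<phi> x" using r by (auto simp: R_def)
      have "\<phi> (fun_act i (\<sigma>0 (proj J r))) = fun_act i (\<phi> x)"
        by (simp add: dlinear_act[OF \<phi>] x \<sigma>0)
      also have "\<dots> = \<phi> (\<sigma>0 (\<phi> (fun_act i x)))"
        by (simp only: \<sigma>0) (simp add: dlinear_act[OF \<phi>])
      finally show ?thesis by (simp add: dlinear_act[OF proj_dlinear] x dlinear_act[OF \<phi>])
    qed
    show "\<exists>u\<in>V.span B. v - u \<in> R" for v
    proof -
      obtain u x where u: "u \<in> V.span B" "proj J v - u = \<phi> x"
        using B(2)[of "proj J v"] by auto
      have "u = proj J v - \<phi> x" using u(2) by (simp add: algebra_simps)
      moreover have "proj J v - \<phi> x \<in> dvecs J"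
        by (intro dvecs_diff) (use J in auto)
      ultimately have "proj J u = u" by (simp add: proj_id)
      then show ?thesis using u by (intro bexI[of _ u]) (simp_all add: R_def pl)
    qed
  qed
qed

lemma factor_through_first_map:
  fixes \<phi> :: "('i \<Rightarrow> ('n, 'k) dop) \<Rightarrow> ('j \<Rightarrow> ('n, 'k) dop)"
  assumes n: "2 \<le> CARD('n)"
    and \<phi>: "dlinear fun_scale fun_act fun_scale fun_act \<phi>" and J: "range \<phi> \<subseteq> dvecs J"
    and B: "finite B" "\<And>v. v \<in> dvecs J \<Longrightarrow> \<exists>u\<in>module.span fun_scale B. v - u \<in> range \<phi>"
    and f: "dlinear fun_scale fun_act cmul (dvar_mul pd) f" "\<And>x. \<phi> x = 0 \<Longrightarrow> f x = 0"
  shows "\<exists>g. dlinear fun_scale fun_act cmul (dvar_mul pd) g \<and> (\<forall>x. g (\<phi> x) = f x)"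
proof -
  obtain \<sigma> R where "finite_cokernel pd fun_scale fun_act fun_scale fun_act \<phi> \<sigma> R B"
    using finite_cokernel_free[OF \<phi> J B] by blast
  then interpret finite_cokernel pd fun_scale fun_act fun_scale fun_act \<phi> \<sigma> R B .
  show ?thesis by (rule extend_from_image[OF n f])
qed

text \<open>By exactness, \<open>f\<close> induces a D-linear form on the image of
  \<open>\<psi>\<close>, which is the kernel of \<open>\<phi>\<close> in D^I. Once that form extends
  to D^I, the extension is the wanted \<open>g\<close>.\<close>

lemma factor_through_second_map:
  fixes \<phi> :: "('i \<Rightarrow> ('n, 'k) dop) \<Rightarrow> ('j \<Rightarrow> ('n, 'k) dop)"
    and \<psi> :: "('l \<Rightarrow> ('n, 'k) dop) \<Rightarrow> ('i \<Rightarrow> ('n, 'k) dop)"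
  assumes n: "3 \<le> CARD('n)" and fin: "finite J"
    and \<phi>: "dlinear fun_scale fun_act fun_scale fun_act \<phi>" and J: "range \<phi> \<subseteq> dvecs J"
    and B: "finite B" "\<And>v. v \<in> dvecs J \<Longrightarrow> \<exists>u\<in>module.span fun_scale B. v - u \<in> range \<phi>"
    and \<psi>: "dlinear fun_scale fun_act fun_scale fun_act \<psi>"
    and I: "\<And>x. \<phi> (proj I x) = \<phi> x" "range \<psi> = {x \<in> dvecs I. \<phi> x = 0}"
    and f: "dlinear fun_scale fun_act cmul (dvar_mul pd) f" "\<And>x. \<psi> x = 0 \<Longrightarrow> f x = 0"
  shows "\<exists>g. dlinear fun_scale fun_act cmul (dvar_mul pd) g \<and> (\<forall>x. g (\<psi> x) = f x)"
proof -
  obtain \<sigma> R where "finite_cokernel pd fun_scale fun_act fun_scale fun_act \<phi> \<sigma> R B"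
    using finite_cokernel_free[OF \<phi> J B] by blast
  then interpret finite_cokernel pd fun_scale fun_act fun_scale fun_act \<phi> \<sigma> R B .
  interpret U: dmodule pd fun_scale "fun_act :: 'n \<Rightarrow> ('l \<Rightarrow> ('n, 'k) dop) \<Rightarrow> _" by (rule dmodule_fun)
  interpret P: vector_space_pair "fun_scale :: 'k \<Rightarrow> ('l \<Rightarrow> ('n, 'k) dop) \<Rightarrow> _"
    "fun_scale :: 'k \<Rightarrow> ('i \<Rightarrow> ('n, 'k) dop) \<Rightarrow> _" ..
  note lin = dlinear_linear[OF \<psi>]
  note pl = linear_rules[OF dlinear_linear[OF proj_dlinear]]
  note lr = linear_rules[OF lin]
  note fr = linear_rules[OF dlinear_linear[OF f(1)]]
  obtain \<rho> where \<rho>: "Vector_Spaces.linear fun_scale fun_scale \<rho>" "\<And>x. \<psi> (\<rho> (\<psi> x)) = \<psi> x"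
    using P.linear_exists_right_inverse_on[OF lin U.subspace_UNIV] by auto
  note sr = linear_rules[OF \<rho>(1)]
  have f\<rho>: "f (\<rho> (\<psi> x)) = f x" for x
    using f(2)[of "\<rho> (\<psi> x) - x"] by (simp add: lr fr \<rho>)
  \<comment> \<open>The induced form must be total and K-linear before it can be extended; the right
    inverse \<open>\<rho>\<close> provides this, and D-linearity is claimed only on the kernel of
    \<open>\<phi>\<close>.\<close>
  define f' where "f' = (\<lambda>x. f (\<rho> (proj I x)))"
  have ker: "\<exists>z. proj I x = \<psi> z" if "\<phi> x = 0" for x
  proof -
    have "proj I x \<in> range \<psi>" using that by (simp add: I)
    then show ?thesis by auto
  qed
  have f'\<psi>: "f' (\<psi> z) = f z" for z
  proof -
    have "\<psi> z \<in> dvecs I" using I(2) by auto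
    then show ?thesis by (simp add: f'_def proj_id f\<rho>)
  qed
  have f'_proj: "f' x = f' (proj I x)" for x
    by (simp add: f'_def proj_id)
  have "\<exists>g. dlinear fun_scale fun_act cmul (dvar_mul pd) g \<and> (\<forall>x. \<phi> x = 0 \<longrightarrow> g x = f' x)"
  proof (rule extend_from_kernel[OF n])
    show "Vector_Spaces.linear fun_scale cmul f'"
      by (rule linearI) (simp_all add: f'_def vector_space_fun_scale vector_space_cmul pl sr fr)
    show "f' (fun_act i x) = dvar_mul pd i (f' x)" if zero: "\<phi> x = 0" for i x
    proof -
      obtain z where z: "proj I x = \<psi> z" using ker[OF zero] by blast
      have "f' (fun_act i x) = f' (\<psi> (fun_act i z))"
        by (subst f'_proj) (simp add: dlinear_act[OF proj_dlinear] z dlinear_act[OF \<psi>])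
      moreover have "f' x = f' (\<psi> z)"
        by (subst f'_proj) (simp add: z)
      ultimately show ?thesis by (simp add: f'\<psi> dlinear_act[OF f(1)])
    qed
    show "\<exists>\<tau>. Vector_Spaces.linear fun_scale cmul \<tau> \<and>
        (\<forall>i x. \<tau> (fun_act i (\<phi> x)) = dvar_mul pd i (\<tau> (\<phi> x)) + \<gamma> i (\<phi> x))"
      if "\<And>i. Vector_Spaces.linear fun_scale cmul (\<gamma> i)" "\<And>i j. V.nabla i (\<gamma> j) = V.nabla j (\<gamma> i)" for \<gamma>
      using free_split[OF fin that] J by blast
  qed
  then obtain g where g: "dlinear fun_scale fun_act cmul (dvar_mul pd) g" "\<And>x. \<phi> x = 0 \<Longrightarrow> g x = f' x" by blast
  have "g (\<psi> x) = f x" for x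
  proof -
    have "\<phi> (\<psi> x) = 0" using I(2) by auto
    then show ?thesis by (simp add: g(2) f'\<psi>)
  qed
  then show ?thesis using g(1) by blast
qed

end

section \<open>Compatibility conditions and extension modules\<close>

context differential_field
begin

lemma row_mult_unit:
  assumes "finite I" "i \<in> I"
  shows "row_mult pd I (unit_vec i) A = A i"
  using assms by (simp add: row_mult_def unit_vec_def fun_eq_iff if_distrib[of "\<lambda>x. dmul pd x _"] cong: if_cong)

lemma row_mult_assoc: "(\<lambda>j. \<Sum>k\<in>I. dmul pd (row_mult pd L z B k) (A k j)) = row_mult pd L z (\<lambda>l. row_mult pd I (B l) A)"
  by (simp add: row_mult_def fun_eq_iff dmul_sum_left dmul_sum_right dmul_assoc sum.swap[of _ L I])

lemma ad_row_mult:
  "dadj pd (row_mult pd I x A j) = (\<Sum>i\<in>I. dmul pd (dadj pd (A i j)) (dadj pd (x i)))"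
  by (simp add: row_mult_def dadj_sum dadj_dmul)

text \<open>Adjunction turns rows acting from the left into D-linear forms: \<open>P\<close>
  annihilates \<open>ad pd B\<close> iff right multiplication by the adjoint column of
  \<open>P\<close> kills the rows of \<open>B\<close>. Factoring this form through \<open>A\<close>
  expresses \<open>P\<close> by the rows of \<open>ad pd A\<close>.\<close>

lemma generates_cc_adI:
  assumes I: "finite I" and L: "finite L" and J: "finite J" and A: "A \<in> dmats I J" and B: "B \<in> dmats L I"
    and BA: "\<And>l. l \<in> L \<Longrightarrow> row_mult pd I (B l) A = (\<lambda>_. 0)"
    and range: "\<And>x. row_mult pd I x A \<in> dvecs J"
    and factor: "\<And>f. dlinear fun_scale fun_act cmul (dvar_mul pd) f \<Longrightarrow>
       (\<And>x. row_mult pd I x A = 0 \<Longrightarrow> f x = 0) \<Longrightarrow>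
       \<exists>g. dlinear fun_scale fun_act cmul (dvar_mul pd) g \<and> (\<forall>x. g (row_mult pd I x A) = f x)"
    and exact: "\<And>x. x \<in> dvecs I \<Longrightarrow> row_mult pd I x A = 0 \<Longrightarrow> x \<in> row_module pd L B"
  shows "generates_cc pd J (ad pd A) I (ad pd B)"
  unfolding generates_cc_def
proof (intro conjI equalityI subsetI)
  show "ad pd A \<in> dmats J I"
    using A by (auto simp: dmats_def ad_def)
next
  fix P assume "P \<in> row_module pd J (ad pd A)"
  then obtain x where P: "P = row_mult pd J x (ad pd A)"
    by (auto simp: row_module_range)
  have "P i = 0" if "i \<notin> I" for i
    using A that by (simp add: P row_mult_def ad_def dmats_def)
  moreover have "row_mult pd I P (ad pd B) l = 0" for l
  proof (cases "l \<in> L")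
    case True
    have "(\<Sum>i\<in>I. dmul pd (dadj pd (A i j)) (dadj pd (B l i))) = 0" for j
      using BA[OF True] by (simp flip: ad_row_mult)
    then have "row_mult pd I (ad pd A j) (ad pd B) l = 0" for j
      by (simp add: row_mult_def ad_def)
    then show ?thesis
      using fun_cong[OF row_mult_assoc[where I = I and L = J and z = x and B = "ad pd A" and A = "ad pd B"], of l]
      by (simp add: P) (simp add: row_mult_def)
  next
    case False
    then show ?thesis using B by (simp add: row_mult_def ad_def dmats_def)
  qed
  ultimately show "P \<in> {P \<in> dvecs I. row_mult pd I P (ad pd B) = (\<lambda>_. 0)}"
    by (auto simp: dvecs_def)
next
  fix P assume "P \<in> {P \<in> dvecs I. row_mult pd I P (ad pd B) = (\<lambda>_. 0)}"
  then have P: "P \<in> dvecs I" "\<And>l. row_mult pd I P (ad pd B) l = 0" by auto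
  define f where "f = (\<lambda>x. \<Sum>i\<in>I. dmul pd (x i) (dadj pd (P i)))"
  have f: "dlinear fun_scale fun_act cmul (dvar_mul pd) f"
    by (rule dlinearI[OF vector_space_fun_scale vector_space_cmul])
      (simp_all add: f_def fun_scale_def fun_act_def dmul_add_left dmul_cmul_left dmul_dvar_mul_left
        sum.distrib D.scale_sum_right D.act_sum)
  have fB: "f (B l) = 0" for l
  proof -
    have "f (B l) = dadj pd (row_mult pd I P (ad pd B) l)"
      by (simp add: f_def ad_row_mult) (simp add: ad_def)
    then show ?thesis by (simp add: P)
  qed
  have "\<exists>g. dlinear fun_scale fun_act cmul (dvar_mul pd) g \<and> (\<forall>x. g (row_mult pd I x A) = f x)"
  proof (rule factor[OF f])
    fix x assume "row_mult pd I x A = 0"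
    then obtain z where z: "proj I x = row_mult pd L z B"
      using exact[of "proj I x"] by (auto simp: row_mult_proj row_module_range)
    have "f x = f (proj I x)"
      by (simp add: f_def proj_def)
    also have "\<dots> = (\<Sum>l\<in>L. dmul pd (z l) (f (B l)))"
      by (simp add: z f_def row_mult_def dmul_sum_left dmul_sum_right dmul_assoc sum.swap[of _ L I])
    finally show "f x = 0" by (simp add: fB)
  qed
  then obtain g where g: "dlinear fun_scale fun_act cmul (dvar_mul pd) g" "\<And>x. g (row_mult pd I x A) = f x"
    by blast
  \<comment> \<open>The adjoint column of the values of \<open>g\<close> on the basis; taking
    adjoints in f = g \<circ> A gives P = Q ad(A).\<close>
  define Q where "Q = (\<lambda>j. if j \<in> J then dadj pd (g (unit_vec j)) else 0)"
  have "P i = row_mult pd J Q (ad pd A) i" for i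
  proof (cases "i \<in> I")
    case True
    have "dadj pd (P i) = f (unit_vec i)"
      using I True by (simp add: f_def unit_vec_def if_distrib[of "\<lambda>x. dmul pd x _"] cong: if_cong)
    also have "\<dots> = g (A i)"
      using g(2)[of "unit_vec i"] by (simp add: row_mult_unit[OF I True])
    also have "\<dots> = (\<Sum>j\<in>J. dmul pd (A i j) (g (unit_vec j)))"
      using range[of "unit_vec i"] by (intro dlinear_expand[OF g(1) J]) (simp add: row_mult_unit[OF I True])
    finally have "dadj pd (dadj pd (P i)) = dadj pd (\<Sum>j\<in>J. dmul pd (A i j) (g (unit_vec j)))"
      by simp
    then show ?thesis by (simp add: dadj_sum dadj_dmul row_mult_def ad_def Q_def)
  next
    case False
    then show ?thesis using P(1) A by (simp add: row_mult_def ad_def dmats_def dvecs_def)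
  qed
  then have "P = row_mult pd J Q (ad pd A)" by blast
  then show "P \<in> row_module pd J (ad pd A)"
    by (auto simp: row_module_range)
qed

text \<open>\<open>A\<close>, \<open>A1\<close>, \<open>A2\<close> are consecutive maps of an exact
  sequence of free modules, so the first factorization gives the claim at \<open>A\<close> and the
  second the claim at \<open>A1\<close>.\<close>

lemma no_gapI:
  assumes n: "3 \<le> CARD('n)" and J: "finite J" and A: "A \<in> dmats {..<p} J"
    and B: "finite B" "\<And>v. v \<in> dvecs J \<Longrightarrow> \<exists>u\<in>module.span fun_scale B. v - u \<in> row_module pd {..<p} A"
  shows "no_gap pd p J A"
  unfolding no_gap_def
proof (intro allI impI)
  fix q r :: nat and A1 A2
  assume cc: "generates_cc pd {..<q} A1 {..<p} A" "generates_cc pd {..<r} A2 {..<q} A1"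
  let ?\<phi> = "\<lambda>x. row_mult pd {..<p} x A" and ?\<psi> = "\<lambda>x. row_mult pd {..<q} x A1"
  have A1: "A1 \<in> dmats {..<q} {..<p}" and A2: "A2 \<in> dmats {..<r} {..<q}"
    and ker0: "row_module pd {..<q} A1 = {x \<in> dvecs {..<p}. ?\<phi> x = 0}"
    and ker1: "row_module pd {..<r} A2 = {x \<in> dvecs {..<q}. ?\<psi> x = 0}"
    using cc by (simp_all add: generates_cc_def zero_fun_def)
  have row: "M i \<in> row_module pd {..<k} M" if "i \<in> {..<k}" for M :: "nat \<Rightarrow> nat \<Rightarrow> ('n, 'k) dop" and i k
  proof -
    have "M i = row_mult pd {..<k} (unit_vec i) M"
      using that by (simp add: row_mult_unit)
    then show ?thesis unfolding row_module_range by (intro range_eqI[of _ _ "unit_vec i"])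
  qed
  have range: "row_mult pd I x M \<in> dvecs L" if "M \<in> dmats I L"
    for I :: "nat set" and L :: "'l set" and x and M :: "nat \<Rightarrow> 'l \<Rightarrow> ('n, 'k) dop"
    using that by (simp add: row_mult_def dmats_def dvecs_def)
  have range0: "range ?\<phi> \<subseteq> dvecs J"
    using range[OF A] by auto
  have B2: "\<exists>u\<in>module.span fun_scale B. v - u \<in> range ?\<phi>" if "v \<in> dvecs J" for v
    using B(2)[OF that] by (simp add: row_module_range)
  show "generates_cc pd J (ad pd A) {..<p} (ad pd A1) \<and> generates_cc pd {..<p} (ad pd A1) {..<q} (ad pd A2)"
  proof (intro conjI)
    show "generates_cc pd J (ad pd A) {..<p} (ad pd A1)"
    proof (rule generates_cc_adI[OF _ _ J A A1])
      show "row_mult pd {..<p} (A1 l) A = (\<lambda>_. 0)" if "l \<in> {..<q}" for l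
        using row[OF that, of A1] by (simp add: ker0 zero_fun_def)
      show "\<exists>g. dlinear fun_scale fun_act cmul (dvar_mul pd) g \<and> (\<forall>x. g (?\<phi> x) = f x)"
        if "dlinear fun_scale fun_act cmul (dvar_mul pd) f" "\<And>x. ?\<phi> x = 0 \<Longrightarrow> f x = 0" for f
        using n by (intro factor_through_first_map[OF _ row_mult_dlinear range0 B(1) B2 that]) auto
    qed (use range[OF A] ker0 in auto)
    show "generates_cc pd {..<p} (ad pd A1) {..<q} (ad pd A2)"
    proof (rule generates_cc_adI[OF _ _ _ A1 A2])
      show "row_mult pd {..<q} (A2 l) A1 = (\<lambda>_. 0)" if "l \<in> {..<r}" for l
        using row[OF that, of A2] by (simp add: ker1 zero_fun_def)
      show "\<exists>g. dlinear fun_scale fun_act cmul (dvar_mul pd) g \<and> (\<forall>x. g (?\<psi> x) = f x)"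
        if "dlinear fun_scale fun_act cmul (dvar_mul pd) f" "\<And>x. ?\<psi> x = 0 \<Longrightarrow> f x = 0" for f
        by (rule factor_through_second_map[OF n J row_mult_dlinear range0 B(1) B2 row_mult_dlinear
              row_mult_proj _ that])
          (simp_all add: ker0 flip: row_module_range)
    qed (use range[OF A1] ker1 in auto)
  qed
qed

section \<open>Vanishing of ext on an arbitrary free resolution\<close>

lemma lhom_free_free:
  assumes "f \<in> lhom (free_module pd I) (free_module pd J)"
  shows "dlinear fun_scale fun_act fun_scale fun_act (\<lambda>x. f (proj I x))"
    and "f (proj I x) \<in> dvecs J"
proof -
  have f: "\<And>x y. x \<in> dvecs I \<Longrightarrow> y \<in> dvecs I \<Longrightarrow> f (x + y) = f x + f y"
    "\<And>P x. x \<in> dvecs I \<Longrightarrow> f (\<lambda>i. dmul pd P (x i)) = (\<lambda>j. dmul pd P (f x j))"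
    "\<And>x. x \<in> dvecs I \<Longrightarrow> f x \<in> dvecs J"
    using assms by (auto simp: lhom_def free_module_def plus_fun_def)
  show "f (proj I x) \<in> dvecs J" by (simp add: f)
  have "(\<lambda>i. dmul pd (Poly_Mapping.single {#} c) (proj I x i)) = proj I (fun_scale c x)" for c x
    by (auto simp: dmul_const proj_def fun_scale_def)
  moreover have "(\<lambda>i. dmul pd (Poly_Mapping.single {#i'#} 1) (proj I x i)) = proj I (fun_act i' x)" for i' x
    by (auto simp: dmul_var proj_def fun_act_def)
  ultimately show "dlinear fun_scale fun_act fun_scale fun_act (\<lambda>x. f (proj I x))"
    using f(2)[of "proj I _" "Poly_Mapping.single {#} _"] f(2)[of "proj I _" "Poly_Mapping.single {#_#} 1"]
    by (intro dlinearI vector_space_fun_scale)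
      (simp_all add: f proj_add fun_scale_def[of _ "f _"] fun_act_def[of _ "f _"] dmul_const dmul_var)
qed

lemma lhom_free_regular:
  assumes "f \<in> lhom (free_module pd I) (regular_module pd)"
  shows "dlinear fun_scale fun_act cmul (dvar_mul pd) (\<lambda>x. f (proj I x))"
proof -
  have f: "\<And>x y. x \<in> dvecs I \<Longrightarrow> y \<in> dvecs I \<Longrightarrow> f (x + y) = f x + f y"
    "\<And>P x. x \<in> dvecs I \<Longrightarrow> f (\<lambda>i. dmul pd P (x i)) = dmul pd P (f x)"
    using assms by (auto simp: lhom_def free_module_def regular_module_def plus_fun_def)
  have "(\<lambda>i. dmul pd (Poly_Mapping.single {#} c) (proj I x i)) = proj I (fun_scale c x)" for c x
    by (auto simp: dmul_const proj_def fun_scale_def)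
  moreover have "(\<lambda>i. dmul pd (Poly_Mapping.single {#i'#} 1) (proj I x i)) = proj I (fun_act i' x)" for i' x
    by (auto simp: dmul_var proj_def fun_act_def)
  ultimately show ?thesis
    using f(2)[of "proj I _" "Poly_Mapping.single {#} _"] f(2)[of "proj I _" "Poly_Mapping.single {#_#} 1"]
    by (intro dlinearI vector_space_fun_scale vector_space_cmul)
      (simp_all add: f proj_add dmul_const dmul_var)
qed

lemma lhom_regularI:
  assumes "dlinear fun_scale fun_act cmul (dvar_mul pd) g"
  shows "restrict g (dvecs I) \<in> lhom (free_module pd I) (regular_module pd)"
proof -
  have "(\<lambda>i. x i + y i) \<in> dvecs I" "(\<lambda>i. dmul pd P (x i)) \<in> dvecs I"
    if "x \<in> dvecs I" "y \<in> dvecs I" for x y P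
    using that by (auto simp: dvecs_def)
  moreover have "g (\<lambda>i. x i + y i) = g x + g y" for x y
    using linear_add[OF dlinear_linear[OF assms], of x y] by (simp add: plus_fun_def)
  ultimately show ?thesis
    by (auto simp: lhom_def free_module_def regular_module_def dlinear_dmul[OF assms])
qed

lemma ext_of_resolution_zero:
  assumes "\<And>f. f \<in> cocycles pd r \<phi> (Suc i) \<Longrightarrow>
     \<exists>g. dlinear fun_scale fun_act cmul (dvar_mul pd) g \<and> (\<forall>x\<in>dvecs {..<r (Suc i)}. f x = g (\<phi> i x))"
    and \<phi>: "\<And>i. \<phi> i \<in> lhom (free_rank pd (r (Suc i))) (free_rank pd (r i))"
  shows "ext_of_resolution pd r \<phi> (Suc i) = {coboundaries pd r \<phi> (Suc i)}"
proof -
  let ?S = "dvecs {..<r (Suc i)} :: (nat \<Rightarrow> ('n, 'k) dop) set"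
  let ?G = "{g. dlinear fun_scale fun_act cmul (dvar_mul pd) g} :: ((nat \<Rightarrow> ('n, 'k) dop) \<Rightarrow> ('n, 'k) dop) set"
  let ?cb = "\<lambda>g. \<lambda>x\<in>?S. g (\<phi> i x)"
  have \<phi>_in: "\<phi> i x \<in> dvecs {..<r i}" if "x \<in> ?S" for x
    using lhom_free_free(2)[OF \<phi>, of i x] that by (simp add: proj_id)
  have cob: "coboundaries pd r \<phi> (Suc i) = ?cb ` ?G"
  proof (intro equalityI subsetI)
    fix b assume "b \<in> coboundaries pd r \<phi> (Suc i)"
    then obtain g where g: "g \<in> lhom (free_rank pd (r i)) (regular_module pd)" "b = ?cb g"
      by (auto simp: coboundaries_def)
    then have "b = ?cb (\<lambda>x. g (proj {..<r i} x))"
      by (auto simp: proj_id \<phi>_in)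
    then show "b \<in> ?cb ` ?G"
      using lhom_free_regular[OF g(1)] by (intro image_eqI[of _ _ "\<lambda>x. g (proj {..<r i} x)"]) simp_all
  next
    fix b assume "b \<in> ?cb ` ?G"
    then obtain g where g: "g \<in> ?G" "b = ?cb g" by blast
    then have "b = ?cb (restrict g (dvecs {..<r i}))"
      by (auto simp: \<phi>_in)
    moreover have "restrict g (dvecs {..<r i}) \<in> lhom (free_rank pd (r i)) (regular_module pd)"
      using g(1) by (intro lhom_regularI) simp
    ultimately show "b \<in> coboundaries pd r \<phi> (Suc i)"
      unfolding coboundaries_def nat.case by (rule image_eqI)
  qed
  have G_add: "(\<lambda>x. g x + h x) \<in> ?G" and G_diff: "(\<lambda>x. g x - h x) \<in> ?G" if "g \<in> ?G" "h \<in> ?G" for g h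
  proof -
    have dl: "dlinear fun_scale fun_act cmul (dvar_mul pd) g" "dlinear fun_scale fun_act cmul (dvar_mul pd) h"
      using that by simp_all
    note rules = linear_rules[OF dlinear_linear[OF dl(1)]] linear_rules[OF dlinear_linear[OF dl(2)]]
      dlinear_act[OF dl(1)] dlinear_act[OF dl(2)]
    show "(\<lambda>x. g x + h x) \<in> ?G" "(\<lambda>x. g x - h x) \<in> ?G"
      by (auto intro!: dlinearI vector_space_fun_scale vector_space_cmul
          simp: rules D.scale_right_distrib D.scale_right_diff_distrib D.act_add D.act_diff)
  qed
  have coset: "(\<lambda>b. \<lambda>x\<in>?S. f x + b x) ` coboundaries pd r \<phi> (Suc i) = coboundaries pd r \<phi> (Suc i)"
    if f: "f \<in> cocycles pd r \<phi> (Suc i)" for f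
  proof -
    obtain g where g: "g \<in> ?G" "\<And>x. x \<in> ?S \<Longrightarrow> f x = g (\<phi> i x)"
      using assms(1)[OF f] by blast
    show ?thesis
      unfolding cob
    proof (intro equalityI subsetI)
      fix b assume "b \<in> (\<lambda>b. \<lambda>x\<in>?S. f x + b x) ` ?cb ` ?G"
      then obtain h where h: "h \<in> ?G" "b = (\<lambda>x\<in>?S. f x + ?cb h x)" by blast
      then have "b = ?cb (\<lambda>x. g x + h x)"
        by (auto simp: g)
      then show "b \<in> ?cb ` ?G" using G_add[OF g(1) h(1)] by (rule image_eqI)
    next
      fix b assume "b \<in> ?cb ` ?G"
      then obtain h where h: "h \<in> ?G" "b = ?cb h" by blast
      then have "b = (\<lambda>x\<in>?S. f x + ?cb (\<lambda>x. h x - g x) x)"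
        by (auto simp: g)
      then show "b \<in> (\<lambda>b. \<lambda>x\<in>?S. f x + b x) ` ?cb ` ?G"
        using imageI[OF G_diff[OF h(1) g(1)], of ?cb] by (rule image_eqI)
    qed
  qed
  have "dlinear fun_scale fun_act cmul (dvar_mul pd) (\<lambda>x. 0)"
    by (rule dlinearI) (simp_all add: vector_space_fun_scale vector_space_cmul)
  \<comment> \<open>The zero cocycle shows that the set of classes is nonempty, hence equal to the
    singleton rather than merely contained in it.\<close>
  from lhom_regularI[OF this]
  have "(\<lambda>x\<in>?S. 0) \<in> cocycles pd r \<phi> (Suc i)"
  proof -
    have "\<phi> (Suc i) x \<in> ?S" if "x \<in> dvecs {..<r (Suc (Suc i))}" for x
      using lhom_free_free(2)[OF \<phi>, of "Suc i" x] that by (simp add: proj_id)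
    then show ?thesis
      using lhom_regularI[OF \<open>dlinear fun_scale fun_act cmul (dvar_mul pd) (\<lambda>x. 0)\<close>]
      by (simp add: cocycles_def)
  qed
  then show ?thesis
    unfolding ext_of_resolution_def using coset by blast
qed

text \<open>The start of a resolution need not be the given presentation, but both free modules map
  onto M; a finite set spanning modulo the relations is carried from one to the other.\<close>

lemma resolution_span:
  fixes A :: "'i \<Rightarrow> 'j \<Rightarrow> ('n, 'k) dop" and L :: "'l set"
  assumes A: "A \<in> dmats I J"
    and B: "finite B" "\<And>v. v \<in> dvecs J \<Longrightarrow> \<exists>u\<in>module.span fun_scale B. v - u \<in> row_module pd I A"
    and \<epsilon>: "\<epsilon> \<in> lhom (free_module pd L) (differential_module pd I J A)"
      "\<epsilon> ` dvecs L = mcarrier (differential_module pd I J A)"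
  shows "\<exists>C. finite C \<and> (\<forall>v\<in>dvecs L. \<exists>u\<in>module.span fun_scale C.
     v - u \<in> {x \<in> dvecs L. \<epsilon> x = mzero (differential_module pd I J A)})"
proof -
  interpret F: dmodule pd fun_scale "fun_act :: 'n \<Rightarrow> ('j \<Rightarrow> ('n, 'k) dop) \<Rightarrow> _" by (rule dmodule_fun)
  interpret G: dmodule pd fun_scale "fun_act :: 'n \<Rightarrow> ('l \<Rightarrow> ('n, 'k) dop) \<Rightarrow> _" by (rule dmodule_fun)
  let ?M = "differential_module pd I J A"
  define R where "R = row_module pd I A"
  have "F.subspace R"
    unfolding R_def by (rule row_module_subspace)
  note R_add = F.subspace_add[OF this] and R_diff = F.subspace_diff[OF this]
    and R_0 = F.subspace_0[OF this] and R_scale = F.subspace_scale[OF this]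
  define \<pi> where "\<pi> x = {x + y | y. y \<in> R}" for x :: "'j \<Rightarrow> ('n, 'k) dop"
  have carrier: "mcarrier ?M = \<pi> ` dvecs J"
    by (auto simp: differential_module_def quotient_module_def coset_of_def \<pi>_def R_def free_module_def plus_fun_def)
  have zero: "mzero ?M = R"
    by (simp add: differential_module_def quotient_module_def R_def)
  have \<pi>_iff: "\<pi> x = \<pi> y \<longleftrightarrow> x - y \<in> R" for x y
  proof
    assume "\<pi> x = \<pi> y"
    moreover have "x \<in> \<pi> x" using R_0 by (auto simp: \<pi>_def intro!: exI[of _ 0])
    ultimately show "x - y \<in> R" by (auto simp: \<pi>_def)
  next
    assume R: "x - y \<in> R"
    have "x + z = y + ((x - y) + z)" "y + z = x + (z - (x - y))" for z by simp_all
    then show "\<pi> x = \<pi> y"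
      using R_add[OF R] R_diff[OF _ R] unfolding \<pi>_def by blast
  qed
  have \<pi>_zero: "\<pi> x = R \<longleftrightarrow> x \<in> R" for x
    using \<pi>_iff[of x 0] by (simp add: \<pi>_def)
  have madd: "madd ?M (\<pi> x) (\<pi> y) = \<pi> (x + y)" for x y
  proof -
    have "madd ?M (\<pi> x) (\<pi> y) = {u + v | u v. u \<in> \<pi> x \<and> v \<in> \<pi> y}"
      by (simp add: differential_module_def quotient_module_def free_module_def plus_fun_def)
    also have "\<dots> = \<pi> (x + y)"
    proof (intro equalityI subsetI)
      fix w assume "w \<in> {u + v | u v. u \<in> \<pi> x \<and> v \<in> \<pi> y}"
      then obtain a b where "a \<in> R" "b \<in> R" "w = (x + a) + (y + b)" by (auto simp: \<pi>_def)
      then show "w \<in> \<pi> (x + y)"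
        using R_add by (auto simp: \<pi>_def algebra_simps intro!: exI[of _ "a + b"])
    next
      fix w assume "w \<in> \<pi> (x + y)"
      then obtain a where "a \<in> R" "w = (x + 0) + (y + a)" by (auto simp: \<pi>_def add.assoc)
      then show "w \<in> {u + v | u v. u \<in> \<pi> x \<and> v \<in> \<pi> y}"
        using R_0 unfolding \<pi>_def by blast
    qed
    finally show ?thesis .
  qed
  have mscale: "msmult ?M (Poly_Mapping.single {#} c) (\<pi> x) = \<pi> (fun_scale c x)" for c x
  proof -
    have "msmult ?M (Poly_Mapping.single {#} c) (\<pi> x) = {fun_scale c u + v | u v. u \<in> \<pi> x \<and> v \<in> R}"
      by (simp add: differential_module_def quotient_module_def free_module_def plus_fun_def dmul_const
          fun_scale_def R_def)
    also have "\<dots> = \<pi> (fun_scale c x)"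
    proof (intro equalityI subsetI)
      fix w assume "w \<in> {fun_scale c u + v | u v. u \<in> \<pi> x \<and> v \<in> R}"
      then obtain a b where "a \<in> R" "b \<in> R" "w = fun_scale c (x + a) + b" by (auto simp: \<pi>_def)
      then show "w \<in> \<pi> (fun_scale c x)"
        using R_add R_scale by (auto simp: \<pi>_def F.scale_right_distrib intro!: exI[of _ "fun_scale c a + b"])
    next
      fix w assume "w \<in> \<pi> (fun_scale c x)"
      then obtain a where "a \<in> R" "w = fun_scale c (x + 0) + a" by (auto simp: \<pi>_def)
      then show "w \<in> {fun_scale c u + v | u v. u \<in> \<pi> x \<and> v \<in> R}"
        using R_0 unfolding \<pi>_def by blast
    qed
    finally show ?thesis .
  qed
  \<comment> \<open>The fibre product over M, used as a K-linear correspondence in place of a map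
    between the free modules.\<close>
  define rel where "rel x z \<longleftrightarrow> x \<in> dvecs L \<and> \<epsilon> x = \<pi> z" for x z
  have rel_add: "rel (x + y) (z + w)" if "rel x z" "rel y w" for x y z w
    using \<epsilon>(1) that madd[of z w] by (auto simp: rel_def lhom_def free_module_def plus_fun_def dvecs_def)
  have rel_scale: "rel (fun_scale c x) (fun_scale c z)" if "rel x z" for c x z
  proof -
    have "\<epsilon> (\<lambda>i. dmul pd (Poly_Mapping.single {#} c) (x i)) = msmult ?M (Poly_Mapping.single {#} c) (\<epsilon> x)"
      using \<epsilon>(1) that by (simp add: rel_def lhom_def free_module_def)
    then have "\<epsilon> (fun_scale c x) = msmult ?M (Poly_Mapping.single {#} c) (\<epsilon> x)"
      by (simp add: dmul_const fun_scale_def)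
    then show ?thesis using that by (auto simp: rel_def mscale dvecs_def fun_scale_def)
  qed
  have rel_left: "\<exists>z\<in>dvecs J. rel x z" if "x \<in> dvecs L" for x
  proof -
    have "\<epsilon> x \<in> \<pi> ` dvecs J"
      unfolding carrier[symmetric] \<epsilon>(2)[symmetric] using that by (rule imageI)
    then show ?thesis using that by (auto simp: rel_def)
  qed
  have rel_0: "rel 0 0"
  proof -
    obtain z where "rel 0 z"
      using rel_left[OF dvecs_zero] by blast
    from rel_scale[OF this, of 0] show ?thesis by simp
  qed
  have rel_right: "\<exists>x. rel x z" if "z \<in> dvecs J" for z
  proof -
    have "\<pi> z \<in> \<epsilon> ` dvecs L"
      unfolding \<epsilon>(2) carrier using that by (rule imageI)
    then show ?thesis by (auto simp: rel_def)
  qed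
  have proj_R: "proj J x = x" if "x \<in> R" for x
    using that A by (intro proj_id) (auto simp: R_def row_module_range row_mult_def dmats_def dvecs_def)
  obtain w where w: "\<And>b. rel (w b) (proj J b)"
    using rel_right[OF proj_in] by metis
  have span: "\<exists>y\<in>G.span (w ` B). rel y (proj J u)" if "u \<in> F.span B" for u
    using that
  proof (induction rule: F.span_induct_alt)
    case base
    then show ?case
      using rel_0 G.span_zero linear_zero[OF dlinear_linear[OF proj_dlinear]] by metis
  next
    case (step c x y)
    then obtain y' where y': "y' \<in> G.span (w ` B)" "rel y' (proj J y)" by blast
    have "rel (fun_scale c (w x) + y') (proj J (fun_scale c x + y))"
      using rel_add[OF rel_scale[OF w] y'(2)]
      by (simp add: linear_rules[OF dlinear_linear[OF proj_dlinear]])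
    moreover have "fun_scale c (w x) + y' \<in> G.span (w ` B)"
      using step(1) by (intro G.span_add G.span_scale y'(1)) (auto intro: G.span_base)
    ultimately show ?case by blast
  qed
  show ?thesis
  proof (intro exI conjI ballI)
    show "finite (w ` B)" using B(1) by simp
    fix v :: "'l \<Rightarrow> ('n, 'k) dop" assume "v \<in> dvecs L"
    then obtain z where z: "z \<in> dvecs J" "rel v z" using rel_left by blast
    obtain u where u: "u \<in> F.span B" "z - u \<in> R" using B(2)[OF z(1)] by (auto simp: R_def)
    obtain y where y: "y \<in> G.span (w ` B)" "rel y (proj J u)" using span[OF u(1)] by blast
    have "u = z - (z - u)" by simp
    then have "proj J u = u"
      using z(1) proj_R[OF u(2)] by (metis dvecs_diff proj_id proj_in)
    then have "rel (v + fun_scale (- 1) y) (z + fun_scale (- 1) u)"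
      using rel_add[OF z(2) rel_scale[OF y(2)], of "-1"] by simp
    then have "rel (v - y) (z - u)" by (simp add: F.scale_minus_left G.scale_minus_left)
    then have "v - y \<in> {x \<in> dvecs L. \<epsilon> x = mzero ?M}"
      using \<pi>_zero u(2) by (simp add: rel_def zero)
    then show "\<exists>u\<in>G.span (w ` B). v - u \<in> {x \<in> dvecs L. \<epsilon> x = mzero ?M}"
      using y(1) by blast
  qed
qed

lemma ext_vanishesI:
  assumes n: "3 \<le> CARD('n)" and A: "A \<in> dmats I J"
    and B: "finite B" "\<And>v. v \<in> dvecs J \<Longrightarrow> \<exists>u\<in>module.span fun_scale B. v - u \<in> row_module pd I A"
  shows "ext_vanishes pd 1 (differential_module pd I J A)"
    and "ext_vanishes pd 2 (differential_module pd I J A)"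
proof -
  let ?M = "differential_module pd I J A"
  have "ext_of_resolution pd r \<phi> (Suc 0) = {coboundaries pd r \<phi> (Suc 0)} \<and>
      ext_of_resolution pd r \<phi> (Suc 1) = {coboundaries pd r \<phi> (Suc 1)}"
    if res: "free_resolution pd ?M r \<phi> \<epsilon>" for r \<phi> \<epsilon>
  proof -
    have \<phi>: "\<And>i. \<phi> i \<in> lhom (free_rank pd (r (Suc i))) (free_rank pd (r i))"
      and e0: "\<phi> 0 ` dvecs {..<r 1} = {x \<in> dvecs {..<r 0}. \<epsilon> x = mzero ?M}"
      and e: "\<And>i. \<phi> (Suc i) ` dvecs {..<r (Suc (Suc i))} = {x \<in> dvecs {..<r (Suc i)}. \<phi> i x = 0}"
      using res by (simp_all add: free_resolution_def zero_fun_def)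
    \<comment> \<open>\<open>\<phi> i\<close> is controlled only on its carrier; precomposing with
      \<open>proj\<close> makes it total and linear without changing its image.\<close>
    define \<Phi> where "\<Phi> i x = \<phi> i (proj {..<r (Suc i)} x)" for i x
    have range: "range (\<Phi> i) = \<phi> i ` dvecs {..<r (Suc i)}" for i
    proof (intro equalityI subsetI)
      show "y \<in> range (\<Phi> i)" if "y \<in> \<phi> i ` dvecs {..<r (Suc i)}" for y
      proof -
        from that obtain x where "x \<in> dvecs {..<r (Suc i)}" "y = \<phi> i x" by blast
        then show ?thesis by (intro range_eqI[of _ _ x]) (simp add: \<Phi>_def proj_id)
      qed
    qed (auto simp: \<Phi>_def)
    have dl: "dlinear fun_scale fun_act fun_scale fun_act (\<Phi> i)" for i
      using lhom_free_free(1)[OF \<phi>] unfolding \<Phi>_def .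
    have sub: "range (\<Phi> i) \<subseteq> dvecs {..<r i}" for i
      using lhom_free_free(2)[OF \<phi>] unfolding \<Phi>_def by blast
    obtain C where C: "finite C" "\<And>v. v \<in> dvecs {..<r 0} \<Longrightarrow>
        \<exists>u\<in>module.span fun_scale C. v - u \<in> range (\<Phi> 0)"
    proof -
      have "\<epsilon> \<in> lhom (free_rank pd (r 0)) ?M" "\<epsilon> ` dvecs {..<r 0} = mcarrier ?M"
        using res by (simp_all add: free_resolution_def)
      from resolution_span[OF A B this] that show ?thesis
        unfolding range e0 One_nat_def[symmetric] by blast
    qed
    have cocycle: "dlinear fun_scale fun_act cmul (dvar_mul pd) (\<lambda>x. f (proj {..<r (Suc i)} x))"
        "\<And>x. \<Phi> i x = 0 \<Longrightarrow> f (proj {..<r (Suc i)} x) = 0"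
      if f: "f \<in> cocycles pd r \<phi> (Suc i)" for f i
    proof -
      show "dlinear fun_scale fun_act cmul (dvar_mul pd) (\<lambda>x. f (proj {..<r (Suc i)} x))"
        using f by (intro lhom_free_regular) (simp add: cocycles_def)
      show "f (proj {..<r (Suc i)} x) = 0" if "\<Phi> i x = 0" for x
      proof -
        have "proj {..<r (Suc i)} x \<in> \<phi> (Suc i) ` dvecs {..<r (Suc (Suc i))}"
          using that by (simp add: e \<Phi>_def)
        then show ?thesis using f by (auto simp: cocycles_def)
      qed
    qed
    show ?thesis
    proof (intro conjI ext_of_resolution_zero \<phi>)
      fix f assume f: "f \<in> cocycles pd r \<phi> (Suc 0)"
      have ex: "\<exists>g. dlinear fun_scale fun_act cmul (dvar_mul pd) g \<and> (\<forall>x. g (\<Phi> 0 x) = f (proj {..<r (Suc 0)} x))"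
        using n by (intro factor_through_first_map[OF _ dl sub C(1) C(2) cocycle[OF f]]) auto
      show "\<exists>g. dlinear fun_scale fun_act cmul (dvar_mul pd) g \<and> (\<forall>x\<in>dvecs {..<r (Suc 0)}. f x = g (\<phi> 0 x))"
      proof -
        from ex obtain g where g: "dlinear fun_scale fun_act cmul (dvar_mul pd) g"
          "\<And>x. g (\<Phi> 0 x) = f (proj {..<r (Suc 0)} x)" by blast
        have "f x = g (\<phi> 0 x)" if "x \<in> dvecs {..<r (Suc 0)}" for x
          using g(2)[of x] that by (simp add: \<Phi>_def proj_id)
        then show ?thesis using g(1) by blast
      qed
    next
      fix f assume f: "f \<in> cocycles pd r \<phi> (Suc 1)"
      have ex: "\<exists>g. dlinear fun_scale fun_act cmul (dvar_mul pd) g \<and> (\<forall>x. g (\<Phi> 1 x) = f (proj {..<r (Suc 1)} x))"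
      proof (rule factor_through_second_map[OF n _ dl sub C(1) C(2) dl _ _ cocycle[OF f]])
        show "\<Phi> 0 (proj {..<r (Suc 0)} x) = \<Phi> 0 x" for x
          by (simp add: \<Phi>_def proj_id)
        show "range (\<Phi> 1) = {x \<in> dvecs {..<r (Suc 0)}. \<Phi> 0 x = 0}"
          unfolding range One_nat_def e by (auto simp: \<Phi>_def proj_id)
      qed auto
      show "\<exists>g. dlinear fun_scale fun_act cmul (dvar_mul pd) g \<and> (\<forall>x\<in>dvecs {..<r (Suc 1)}. f x = g (\<phi> 1 x))"
      proof -
        from ex obtain g where g: "dlinear fun_scale fun_act cmul (dvar_mul pd) g"
          "\<And>x. g (\<Phi> 1 x) = f (proj {..<r (Suc 1)} x)" by blast
        have "f x = g (\<phi> 1 x)" if "x \<in> dvecs {..<r (Suc 1)}" for x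
          using g(2)[of x] that by (simp add: \<Phi>_def proj_id)
        then show ?thesis using g(1) by blast
      qed
    qed
  qed
  then show "ext_vanishes pd 1 ?M" "ext_vanishes pd 2 ?M"
    by (auto simp: ext_vanishes_def numeral_2_eq_2)
qed

end

section \<open>Finite type of the Killing equations\<close>

context dmodule
begin

text \<open>
  The classical prolongation of the (conformal) Killing equations
  $\partial_i\xi_j + \partial_j\xi_i \equiv \omega_{ij}\Theta$ modulo terms of lower order:
  the second derivatives of $\xi$ are determined by $\partial\Theta$ as in the Christoffel
  formula, and the symmetry of the third derivatives then forces $\partial\partial\Theta \equiv 0$ for $n \geq 3$.
\<close>

lemma third_order_vanishes:
  fixes \<omega> \<iota> :: "'n \<Rightarrow> 'n \<Rightarrow> 'k" and Q :: "nat \<Rightarrow> 'v set"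
  assumes n: "3 \<le> CARD('n)" and sym: "\<And>i j. \<omega> i j = \<omega> j i"
    and inv1: "\<And>i j. (\<Sum>k\<in>UNIV. \<omega> i k * \<iota> k j) = (if i = j then 1 else 0)"
    and inv2: "\<And>i j. (\<Sum>k\<in>UNIV. \<iota> i k * \<omega> k j) = (if i = j then 1 else 0)"
    and Q: "\<And>q. subspace (Q q)" "\<And>q i x. x \<in> Q q \<Longrightarrow> act i x \<in> Q (Suc q)" "\<And>q. Q q \<subseteq> Q (Suc q)"
    and \<eta>: "\<And>j. \<eta> j \<in> Q 0" and \<Theta>: "\<Theta> \<in> Q 1"
    and killing: "\<And>i j. act i (\<eta> j) + act j (\<eta> i) - scale (\<omega> i j) \<Theta> \<in> Q 0"
  shows "act l (act i (act j (\<eta> k))) \<in> Q 2"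
proof -
  note Qi = subspace_add[OF Q(1)] subspace_diff[OF Q(1)] subspace_scale[OF Q(1)] subspace_sum[OF Q(1)]
  define S where "S i j k = act i (act j (\<eta> k))" for i j k
  define \<theta> where "\<theta> i = act i \<Theta>" for i
  define W where "W i j = act i (act j \<Theta>)" for i j
  have half: "x \<in> Q q" if "x + x \<in> Q q" for x q
  proof -
    have "x = scale (1 / 2) (x + x)"
      by (simp add: scale_right_distrib flip: scale_left_distrib)
    then show ?thesis by (rule ssubst) (rule Qi(3)[OF that])
  qed
  have first: "S l i j + S l j i - scale (\<omega> i j) (\<theta> l) \<in> Q 1" for l i j
  proof -
    have "act l (act i (\<eta> j) + act j (\<eta> i) - scale (\<omega> i j) \<Theta>) + scale (pd l (\<omega> i j)) \<Theta> \<in> Q 1"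
      using Q(2)[OF killing[of i j], of l] by (intro Qi \<Theta>) simp
    then show ?thesis by (simp add: act_add act_diff act_scale S_def \<theta>_def algebra_simps)
  qed
  have S_comm: "S i j k = S j i k" for i j k
    by (simp add: S_def act_commute)
  \<comment> \<open>Two cyclic permutations of \<open>first\<close> are added and the third
    subtracted; since \<open>S\<close> is symmetric in its first two indices, only
    \<open>S i j k\<close> survives, twice.\<close>
  have second: "S i j k + S i j k - (scale (\<omega> j k) (\<theta> i) + scale (\<omega> i k) (\<theta> j) - scale (\<omega> i j) (\<theta> k)) \<in> Q 1" for i j k
  proof -
    have eq: "S i j k + S i j k - (scale (\<omega> j k) (\<theta> i) + scale (\<omega> i k) (\<theta> j) - scale (\<omega> i j) (\<theta> k))
      = (S i j k + S i k j - scale (\<omega> j k) (\<theta> i)) + (S j k i + S j i k - scale (\<omega> k i) (\<theta> j))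
        - (S k i j + S k j i - scale (\<omega> i j) (\<theta> k))"
      by (simp add: S_comm[of i k j] S_comm[of j i k] S_comm[of j k i] sym[of k i] algebra_simps)
    show ?thesis
      unfolding eq by (intro Qi first)
  qed
  have \<theta>2: "\<theta> i \<in> Q 2" for i
    using Q(2)[OF \<Theta>, of i] by (simp add: \<theta>_def numeral_2_eq_2)
  have third: "act l (S i j k) + act l (S i j k)
      - (scale (\<omega> j k) (W l i) + scale (\<omega> i k) (W l j) - scale (\<omega> i j) (W l k)) \<in> Q 2" for l i j k
  proof -
    have "act l (S i j k + S i j k - (scale (\<omega> j k) (\<theta> i) + scale (\<omega> i k) (\<theta> j) - scale (\<omega> i j) (\<theta> k)))
      + (scale (pd l (\<omega> j k)) (\<theta> i) + scale (pd l (\<omega> i k)) (\<theta> j) - scale (pd l (\<omega> i j)) (\<theta> k)) \<in> Q 2"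
      using Q(2)[OF second[of i j k], of l] by (intro Qi \<theta>2) (simp add: numeral_2_eq_2)
    then show ?thesis by (simp add: act_add act_diff act_scale W_def \<theta>_def algebra_simps)
  qed
  have W_comm: "W i j = W j i" for i j
    by (simp add: W_def act_commute)
  \<comment> \<open>The integrability condition: the third derivative is symmetric in
    \<open>l\<close> and \<open>i\<close>, so its two expressions through \<open>W\<close> agree
    modulo \<open>Q 2\<close>.\<close>
  have Y: "scale (\<omega> i k) (W l j) - scale (\<omega> i j) (W l k) - scale (\<omega> l k) (W i j) + scale (\<omega> l j) (W i k) \<in> Q 2"
    for i j k l
  proof -
    have "act l (S i j k) = act i (S l j k)"
      by (simp add: S_def act_commute)
    then have eq: "scale (\<omega> i k) (W l j) - scale (\<omega> i j) (W l k) - scale (\<omega> l k) (W i j) + scale (\<omega> l j) (W i k)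
      = (act i (S l j k) + act i (S l j k)
          - (scale (\<omega> j k) (W i l) + scale (\<omega> l k) (W i j) - scale (\<omega> l j) (W i k)))
        - (act l (S i j k) + act l (S i j k)
          - (scale (\<omega> j k) (W l i) + scale (\<omega> i k) (W l j) - scale (\<omega> i j) (W l k)))"
      by (simp add: W_comm[of i l] algebra_simps)
    show ?thesis
      unfolding eq by (intro Qi third)
  qed
  define T where "T = (\<Sum>i\<in>UNIV. \<Sum>k\<in>UNIV. scale (\<iota> i k) (W i k))"
  have trace: "(\<Sum>i\<in>UNIV. \<Sum>k\<in>UNIV. \<iota> i k * \<omega> i k) = of_nat CARD('n)"
    by (subst sym) (simp add: inv2)
  have delta: "(\<Sum>k\<in>UNIV. scale (if j = k then 1 else 0) (f k)) = f j" for f :: "'n \<Rightarrow> 'v" and j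
    by (simp add: if_distrib[of "\<lambda>c. scale c _"] cong: if_cong)
  have delta': "(\<Sum>k\<in>UNIV. scale (if k = j then 1 else 0) (f k)) = f j" for f :: "'n \<Rightarrow> 'v" and j
    by (simp add: if_distrib[of "\<lambda>c. scale c _"] cong: if_cong)
  \<comment> \<open>The trace of \<open>Y\<close> over \<open>i\<close>, \<open>k\<close>; a second
    trace gives the factor (n - 2) + n = 2n - 2 on \<open>T\<close>. After \<open>T\<close> is
    removed, n - 2 must still be invertible.\<close>
  have U: "scale (of_nat CARD('n) - 2) (W l j) + scale (\<omega> l j) T \<in> Q 2" for l j
  proof -
    have "(\<Sum>i\<in>UNIV. \<Sum>k\<in>UNIV. scale (\<iota> i k * \<omega> i k) (W l j)) = scale (of_nat CARD('n)) (W l j)"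
      by (simp add: trace flip: scale_sum_left)
    moreover have "(\<Sum>i\<in>UNIV. \<Sum>k\<in>UNIV. scale (\<iota> i k * \<omega> i j) (W l k)) = W l j"
    proof -
      have "(\<Sum>i\<in>UNIV. \<Sum>k\<in>UNIV. scale (\<iota> i k * \<omega> i j) (W l k))
        = (\<Sum>k\<in>UNIV. scale (\<Sum>i\<in>UNIV. \<omega> j i * \<iota> i k) (W l k))"
        by (subst sum.swap) (simp add: scale_sum_left sym[of j] mult.commute)
      then show ?thesis by (simp add: inv1 delta)
    qed
    moreover have "(\<Sum>i\<in>UNIV. \<Sum>k\<in>UNIV. scale (\<iota> i k * \<omega> l k) (W i j)) = W l j"
    proof -
      have "(\<Sum>i\<in>UNIV. \<Sum>k\<in>UNIV. scale (\<iota> i k * \<omega> l k) (W i j))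
        = (\<Sum>i\<in>UNIV. scale (\<Sum>k\<in>UNIV. \<iota> i k * \<omega> k l) (W i j))"
        by (simp add: scale_sum_left sym[of l])
      then show ?thesis by (simp add: inv2 delta')
    qed
    moreover have "(\<Sum>i\<in>UNIV. \<Sum>k\<in>UNIV. scale (\<iota> i k * \<omega> l j) (W i k)) = scale (\<omega> l j) T"
      by (simp add: T_def scale_sum_right mult.commute)
    moreover have "(\<Sum>i\<in>UNIV. \<Sum>k\<in>UNIV. scale (\<iota> i k)
        (scale (\<omega> i k) (W l j) - scale (\<omega> i j) (W l k) - scale (\<omega> l k) (W i j) + scale (\<omega> l j) (W i k))) \<in> Q 2"
      by (intro Qi Y)
    ultimately have "scale (of_nat CARD('n)) (W l j) - W l j - W l j + scale (\<omega> l j) T \<in> Q 2"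
      by (simp add: scale_right_distrib scale_right_diff_distrib sum.distrib sum_subtractf)
    moreover have "scale (of_nat CARD('n) - 2) (W l j) = scale (of_nat CARD('n)) (W l j) - W l j - W l j"
      using scale_left_distrib[of 1 1 "W l j"] by (simp add: scale_left_diff_distrib)
    ultimately show ?thesis by simp
  qed
  have cancel: "x \<in> Q 2" if "scale c x \<in> Q 2" "c \<noteq> 0" for c x
    using Qi(3)[OF that(1), of "1 / c"] that(2) by simp
  have T: "T \<in> Q 2"
  proof (rule cancel)
    have "(\<Sum>l\<in>UNIV. \<Sum>j\<in>UNIV. scale (\<iota> l j) (scale (of_nat CARD('n) - 2) (W l j) + scale (\<omega> l j) T)) \<in> Q 2"
      by (intro Qi U)
    also have "(\<Sum>l\<in>UNIV. \<Sum>j\<in>UNIV. scale (\<iota> l j) (scale (of_nat CARD('n) - 2) (W l j) + scale (\<omega> l j) T))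
      = scale (of_nat CARD('n) - 2) T + scale (of_nat CARD('n)) T"
      by (simp add: scale_right_distrib sum.distrib trace flip: scale_sum_left)
        (simp add: T_def scale_sum_right mult.commute)
    finally show "scale (of_nat (2 * CARD('n) - 2)) T \<in> Q 2"
      using n by (simp add: of_nat_diff flip: scale_left_distrib)
    show "of_nat (2 * CARD('n) - 2) \<noteq> (0 :: 'k)"
      using n by (simp only: of_nat_eq_0_iff)
  qed
  have W: "W l j \<in> Q 2" for l j
  proof (rule cancel)
    have "(scale (of_nat CARD('n) - 2) (W l j) + scale (\<omega> l j) T) - scale (\<omega> l j) T \<in> Q 2"
      by (intro Qi U T)
    then show "scale (of_nat (CARD('n) - 2)) (W l j) \<in> Q 2"
      using n by (simp add: of_nat_diff)
    show "of_nat (CARD('n) - 2) \<noteq> (0 :: 'k)"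
      using n by (simp only: of_nat_eq_0_iff)
  qed
  have "(act l (S i j k) + act l (S i j k)
      - (scale (\<omega> j k) (W l i) + scale (\<omega> i k) (W l j) - scale (\<omega> i j) (W l k)))
      + (scale (\<omega> j k) (W l i) + scale (\<omega> i k) (W l j) - scale (\<omega> i j) (W l k)) \<in> Q 2"
    by (intro Qi third W)
  then have "act l (S i j k) + act l (S i j k) \<in> Q 2"
    by simp
  then have "act l (S i j k) \<in> Q 2"
    by (rule half)
  then show ?thesis by (simp add: S_def)
qed

end

context differential_field
begin

text \<open>Both operators at once: dividing by \<open>\<delta>\<close> and lowering the index
  leaves the Killing form of the equations with \<Theta> equal to \<open>- w\<close> times the
  divergence. Hence second derivatives suffice to span modulo the equations.\<close>

lemma killing_finite_type:
  fixes \<omega> :: "'k ^ 'n ^ 'n" and A :: "nat \<Rightarrow> 'n \<Rightarrow> ('n, 'k) dop"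
  assumes n: "3 \<le> CARD('n)" and \<omega>: "nondegenerate_metric \<omega>" and \<delta>: "\<delta> \<noteq> 0"
    and A: "operator_matrix p e (lie_derivative pd w (\<chi> i j. \<delta> * \<omega> $ i $ j)) A"
  shows "\<exists>B. finite B \<and> (\<forall>v. \<exists>u\<in>module.span fun_scale B. v - u \<in> row_module pd {..<p} A)"
proof -
  interpret F: dmodule pd fun_scale "fun_act :: 'n \<Rightarrow> ('n \<Rightarrow> ('n, 'k) dop) \<Rightarrow> _" by (rule dmodule_fun)
  let ?R = "row_module pd {..<p} A"
  let ?E = "unit_vec :: 'n \<Rightarrow> 'n \<Rightarrow> ('n, 'k) dop"
  have sym: "\<omega> $ i $ j = \<omega> $ j $ i" for i j
    using \<omega> by (auto simp: nondegenerate_metric_def transpose_def vec_eq_iff)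
  have "invertible \<omega>"
    using \<omega> by (simp add: nondegenerate_metric_def invertible_det_nz)
  then have "\<omega> ** matrix_inv \<omega> = mat 1 \<and> matrix_inv \<omega> ** \<omega> = mat 1"
    unfolding invertible_def matrix_inv_def by (rule someI_ex)
  then have inv1: "(\<Sum>k\<in>UNIV. \<omega> $ i $ k * matrix_inv \<omega> $ k $ j) = (if i = j then 1 else 0)"
    and inv2: "(\<Sum>k\<in>UNIV. matrix_inv \<omega> $ i $ k * \<omega> $ k $ j) = (if i = j then 1 else 0)" for i j
    by (simp_all add: matrix_matrix_mult_def mat_def vec_eq_iff)
  have R: "F.subspace ?R"
    by (rule row_module_subspace)
  \<comment> \<open>\<open>?E r\<close> represents \<xi>^r, so \<open>V q\<close> holds the
    derivatives of order at most \<open>q\<close>, and \<open>Q q\<close> below is what they span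
    modulo the equations.\<close>
  define V where "V = rec_nat (range ?E) (\<lambda>_ X. X \<union> (\<Union>i. fun_act i ` X))"
  have V: "V 0 = range ?E" "V (Suc q) = V q \<union> (\<Union>i. fun_act i ` V q)" for q
    by (simp_all add: V_def)
  have V_mono: "v \<in> V (Suc q)" and V_act: "fun_act i v \<in> V (Suc q)" if "v \<in> V q" for v q i
    unfolding V(2)
    by (rule UnI1, rule that) (rule UnI2, rule UN_I[of i], rule UNIV_I, rule imageI, rule that)
  have V_cases: thesis if "v \<in> V (Suc q)" "v \<in> V q \<Longrightarrow> thesis" "\<And>i w. w \<in> V q \<Longrightarrow> v = fun_act i w \<Longrightarrow> thesis"
    for v q thesis
    using that(1) unfolding V(2) by (elim UnE UN_E imageE) (rule that(2) that(3), assumption+)+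
  have finite_V: "finite (V q)" for q
    by (induction q) (simp_all add: V)
  define Q where "Q q = {x. \<exists>u\<in>F.span (V q). x - u \<in> ?R}" for q
  have Q_subspace: "F.subspace (Q q)" for q
  proof (rule F.subspaceI)
    show "0 \<in> Q q"
      using F.span_zero[of "V q"] F.subspace_0[OF R] by (force simp: Q_def)
    fix x y c assume x: "x \<in> Q q"
    then obtain u where u: "u \<in> F.span (V q)" "x - u \<in> ?R" by (auto simp: Q_def)
    have "fun_scale c x - fun_scale c u \<in> ?R"
      using F.subspace_scale[OF R u(2), of c] by (simp add: F.scale_right_diff_distrib)
    then show "fun_scale c x \<in> Q q"
      using F.span_scale[OF u(1)] by (auto simp: Q_def)
    assume "y \<in> Q q"
    then obtain v where v: "v \<in> F.span (V q)" "y - v \<in> ?R" by (auto simp: Q_def)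
    have "(x + y) - (u + v) \<in> ?R"
      using F.subspace_add[OF R u(2) v(2)] by (simp add: algebra_simps)
    then show "x + y \<in> Q q"
      using F.span_add[OF u(1) v(1)] by (auto simp: Q_def)
  qed
  have RQ: "x \<in> Q q" if "x \<in> ?R" for x q
    using F.span_zero that by (force simp: Q_def)
  have VQ: "x \<in> Q q" if "x \<in> V q" for x q
    using F.span_base[OF that] F.subspace_0[OF R] by (auto simp: Q_def intro!: bexI[of _ x])
  have Q_induct: "fun_act i x \<in> Q r" if x: "x \<in> Q q" and VQr: "\<And>v. v \<in> V q \<Longrightarrow> v \<in> Q r \<and> fun_act i v \<in> Q r" for i x q r
  proof -
    obtain u where u: "u \<in> F.span (V q)" "x - u \<in> ?R" using x by (auto simp: Q_def)
    have "fun_act i u \<in> Q r \<and> u \<in> Q r"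
      using u(1)
    proof (induction rule: F.span_induct_alt)
      case base
      show ?case
        unfolding F.act_zero using F.subspace_0[OF Q_subspace] by blast
    next
      case (step c v y)
      then have "v \<in> Q r" "fun_act i v \<in> Q r" "y \<in> Q r" "fun_act i y \<in> Q r"
        using VQr by blast+
      then show ?case
        unfolding F.act_add F.act_scale
        by (intro conjI F.subspace_add[OF Q_subspace] F.subspace_scale[OF Q_subspace])
    qed
    then have "fun_act i u + fun_act i (x - u) \<in> Q r"
      using RQ[OF row_module_act[OF u(2)]] F.subspace_add[OF Q_subspace] by blast
    then show ?thesis by (simp add: F.act_diff)
  qed
  have Q_act: "fun_act i x \<in> Q (Suc q)" if "x \<in> Q q" for i x q
    using that
  proof (rule Q_induct)
    show "v \<in> Q (Suc q) \<and> fun_act i v \<in> Q (Suc q)" if "v \<in> V q" for v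
      using VQ[OF V_act[OF that]] VQ[OF V_mono[OF that]] by (rule conjI[rotated])
  qed
  have Q_mono: "Q q \<subseteq> Q (Suc q)" for q
    using F.span_mono[of "V q" "V (Suc q)"] by (auto simp: Q_def V)
  note Qi = F.subspace_add[OF Q_subspace] F.subspace_diff[OF Q_subspace] F.subspace_scale[OF Q_subspace]
    F.subspace_sum[OF Q_subspace]
  have E0: "?E r \<in> Q 0" for r
    by (rule VQ) (simp add: V)
  \<comment> \<open>The covector \<xi>_j, in which the leading part becomes symmetric; derivatives
    of the metric only add terms in \<open>Q 0\<close>.\<close>
  define \<eta> where "\<eta> j = (\<Sum>r\<in>UNIV. fun_scale (\<omega> $ j $ r) (?E r))" for j
  have \<eta>0: "\<eta> j \<in> Q 0" for j
    unfolding \<eta>_def by (intro Qi E0)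
  define T where "T = (\<Sum>r\<in>UNIV. fun_act r (?E r))"
  have T1: "T \<in> Q 1"
    unfolding T_def One_nat_def by (intro Qi Q_act E0)
  have unit: "?E r t = (if t = r then Poly_Mapping.single {#} 1 else 0)"
    and act_unit: "fun_act i (?E r) t = (if t = r then Poly_Mapping.single {#i#} 1 else 0)" for i r t
    by (auto simp: fun_act_def unit_vec_def dvar_mul_single)
  have killing: "fun_act i (\<eta> j) + fun_act j (\<eta> i) - fun_scale (\<omega> $ i $ j) (fun_scale (- w) T) \<in> Q 0" for i j
  proof -
    let ?L = "\<lambda>r. lie_derivative pd w (\<chi> i j. \<delta> * \<omega> $ i $ j) i j r"
    \<comment> \<open>The frame coefficients recombine the rows of \<open>A\<close> into a tensor
      component, so each tensor equation lies in the row module.\<close>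
    have "?L = row_mult pd {..<p} (\<lambda>k. Poly_Mapping.single {#} (e k $ i $ j)) A"
      using A by (simp add: operator_matrix_def row_mult_def dmul_const)
    then have "?L \<in> ?R" by (simp add: row_module_range)
    then have L: "fun_scale (1 / \<delta>) ?L \<in> Q 0"
      by (intro Qi RQ)
    have "fun_scale (1 / \<delta>) ?L = (\<Sum>r\<in>UNIV. fun_scale (\<omega> $ r $ j) (fun_act i (?E r)))
      + (\<Sum>r\<in>UNIV. fun_scale (\<omega> $ r $ i) (fun_act j (?E r))) + fun_scale (w * \<omega> $ i $ j) T
      + (\<Sum>r\<in>UNIV. fun_scale (pd r (\<delta> * \<omega> $ i $ j) / \<delta>) (?E r))"
      using \<delta> by (auto simp: fun_eq_iff sum_fun_apply fun_scale_def act_unit unit T_def lie_derivative_def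
          if_distrib[of "cmul _"] cmul_add_right sym[of i] cong: if_cong)
    moreover have "(\<Sum>r\<in>UNIV. fun_scale (\<omega> $ r $ j) (fun_act i (?E r)))
      = fun_act i (\<eta> j) - (\<Sum>r\<in>UNIV. fun_scale (pd i (\<omega> $ j $ r)) (?E r))" for i j
      by (simp add: \<eta>_def F.act_sum F.act_scale sum.distrib sym[of _ j])
    ultimately have eq: "fun_act i (\<eta> j) + fun_act j (\<eta> i) - fun_scale (\<omega> $ i $ j) (fun_scale (- w) T)
      = fun_scale (1 / \<delta>) ?L + (\<Sum>r\<in>UNIV. fun_scale (pd i (\<omega> $ j $ r)) (?E r))
        + (\<Sum>r\<in>UNIV. fun_scale (pd j (\<omega> $ i $ r)) (?E r))
        - (\<Sum>r\<in>UNIV. fun_scale (pd r (\<delta> * \<omega> $ i $ j) / \<delta>) (?E r))"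
      by (simp add: mult.commute F.scale_minus_left algebra_simps)
    show ?thesis
      unfolding eq by (intro Qi L E0)
  qed
  have third_\<eta>: "fun_act l (fun_act i (fun_act j (\<eta> k))) \<in> Q 2" for l i j k
  proof (rule F.third_order_vanishes[OF n sym inv1 inv2 Q_subspace Q_act Q_mono _ _ killing])
    show "\<eta> j \<in> Q 0" for j
      by (rule \<eta>0)
    show "fun_scale (- w) T \<in> Q 1"
      by (intro Qi T1)
  qed
  have third: "fun_act l (fun_act i (fun_act j (?E r))) \<in> Q 2" for l i j r
  proof -
    \<comment> \<open>Raising the index back differentiates the inverse metric as well, which
      produces these lower derivatives of \<open>\<eta>\<close>.\<close>
    have lower: "fun_act l (fun_act i (\<eta> k)) \<in> Q 2" "fun_act l (\<eta> k) \<in> Q 2" "\<eta> k \<in> Q 2" for l i k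
      unfolding numeral_2_eq_2 by (intro Q_act subsetD[OF Q_mono] \<eta>0)+
    have "(\<Sum>k\<in>UNIV. fun_scale (matrix_inv \<omega> $ r $ k) (\<eta> k))
      = (\<Sum>s\<in>UNIV. fun_scale (\<Sum>k\<in>UNIV. matrix_inv \<omega> $ r $ k * \<omega> $ k $ s) (?E s))"
      by (simp add: \<eta>_def F.scale_sum_right F.scale_sum_left) (rule sum.swap)
    also have "\<dots> = ?E r"
      by (simp add: inv2 if_distrib[of "\<lambda>c. fun_scale c _"] cong: if_cong)
    finally have E: "?E r = (\<Sum>k\<in>UNIV. fun_scale (matrix_inv \<omega> $ r $ k) (\<eta> k))" ..
    show ?thesis
      unfolding E F.act_sum F.act_scale F.act_add by (intro Qi lower third_\<eta>)
  qed
  \<comment> \<open>Stability of \<open>Q 2\<close> closes the prolongation: it contains the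
    generators and is preserved by every \<open>d_i\<close>, so it is all of D^n.\<close>
  have Q2_act: "fun_act i x \<in> Q 2" if "x \<in> Q 2" for i x
    using that
  proof (rule Q_induct)
    fix v assume v: "v \<in> V 2"
    have low: "fun_act i x \<in> Q 2" if "x \<in> V 1" for x
      using VQ[OF V_act[OF that]] by (simp add: numeral_2_eq_2)
    from v have "fun_act i v \<in> Q 2"
      unfolding numeral_2_eq_2
    proof (rule V_cases)
      show "fun_act i v \<in> Q (Suc (Suc 0))" if "v \<in> V (Suc 0)"
        using low that by (simp add: numeral_2_eq_2)
      fix l w assume w: "w \<in> V (Suc 0)" and v: "v = fun_act l w"
      from w show "fun_act i v \<in> Q (Suc (Suc 0))"
      proof (rule V_cases)
        assume "w \<in> V 0"
        then have "v \<in> V 1" by (simp add: V_act v)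
        then show ?thesis using low by (simp add: numeral_2_eq_2)
      next
        fix j u assume "u \<in> V 0" and w: "w = fun_act j u"
        then obtain r where "u = ?E r" by (auto simp: V(1))
        then show ?thesis using third[of i l j r] by (simp add: v w numeral_2_eq_2)
      qed
    qed
    with VQ[OF v] show "v \<in> Q 2 \<and> fun_act i v \<in> Q 2" by (rule conjI)
  qed
  have fold: "fold_mset fun_act (?E r) \<mu> \<in> Q 2" for r \<mu>
  proof (induction \<mu>)
    case empty
    then show ?case using E0[of r] Q_mono[of 0] Q_mono[of 1] by (auto simp: numeral_2_eq_2)
  qed (simp add: Q2_act)
  have "v \<in> Q 2" for v
  proof -
    have "F.app P (?E r) \<in> Q 2" for P r
      unfolding F.app_def by (intro Qi fold)
    then have "(\<Sum>r\<in>UNIV. F.app (v r) (?E r)) \<in> Q 2"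
      by (intro Qi)
    then show ?thesis
      using fun_expand[of UNIV v] by (simp add: dvecs_def)
  qed
  then show ?thesis
    using finite_V by (intro exI[of _ "V 2"]) (auto simp: Q_def)
qed

end

theorem corollary2p6:
  fixes pd :: "'n::finite \<Rightarrow> 'k::field_char_0 \<Rightarrow> 'k"
    and \<omega> :: "'k ^ 'n ^ 'n"
  assumes "differential_field pd"
    and "CARD('n) \<ge> 3"
    and "nondegenerate_metric \<omega>"
    and "constant_curvature pd \<omega>"
  shows "(\<forall>p A. is_killing_operator pd \<omega> p A \<longrightarrow>
            ext_vanishes pd 1 (differential_module pd {..<p} UNIV A) \<and>
            ext_vanishes pd 2 (differential_module pd {..<p} UNIV A) \<and>
            no_gap pd p UNIV A)
       \<and> (\<forall>p A. is_conformal_killing_operator pd \<omega> p A \<longrightarrow>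
            ext_vanishes pd 1 (differential_module pd {..<p} UNIV A) \<and>
            ext_vanishes pd 2 (differential_module pd {..<p} UNIV A) \<and>
            no_gap pd p UNIV A)"
proof -
  interpret differential_field pd by fact
  \<comment> \<open>The Killing operator is the case \<open>w = 0\<close>,
    \<open>\<delta> = 1\<close>; the conformal one has \<open>w = -2/n\<close> and the conformal
    factor as \<open>\<delta>\<close>.\<close>
  have main: "ext_vanishes pd 1 (differential_module pd {..<p} UNIV A) \<and>
      ext_vanishes pd 2 (differential_module pd {..<p} UNIV A) \<and> no_gap pd p UNIV A"
    if A: "operator_matrix p e (lie_derivative pd w (\<chi> i j. \<delta> * \<omega> $ i $ j)) A" and "\<delta> \<noteq> 0" for p A e w \<delta>
  proof -
    obtain B where B: "finite B" "\<And>v. \<exists>u\<in>module.span fun_scale B. v - u \<in> row_module pd {..<p} A"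
      using killing_finite_type[OF assms(2,3) \<open>\<delta> \<noteq> 0\<close> A] by blast
    have "A \<in> dmats {..<p} UNIV"
      using A by (simp add: operator_matrix_def)
    then show ?thesis
      using ext_vanishesI[OF assms(2) _ B] no_gapI[OF assms(2) _ _ B] by simp
  qed
  have \<omega>: "(\<chi> i j. 1 * \<omega> $ i $ j) = \<omega>"
    by (simp add: vec_eq_iff)
  have \<delta>: "\<delta> \<noteq> 0" if "conformal_factor \<omega> \<delta>" for \<delta>
    using that assms(2) by (auto simp: conformal_factor_def power_0_left)
  show ?thesis
    unfolding is_killing_operator_def is_conformal_killing_operator_def
  proof (intro conjI[of "All _" "All _"] allI impI; elim exE conjE)
    show "ext_vanishes pd 1 (differential_module pd {..<p} UNIV A) \<and>
        ext_vanishes pd 2 (differential_module pd {..<p} UNIV A) \<and> no_gap pd p UNIV A"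
      if "operator_matrix p e (lie_derivative pd 0 \<omega>) A" for p A e
      using main[of p e 0 1 A] that by (simp add: \<omega>)
    show "ext_vanishes pd 1 (differential_module pd {..<p} UNIV A) \<and>
        ext_vanishes pd 2 (differential_module pd {..<p} UNIV A) \<and> no_gap pd p UNIV A"
      if "conformal_factor \<omega> \<delta>"
        "operator_matrix p e (lie_derivative pd (- 2 / of_nat CARD('n)) (\<chi> i j. \<delta> * \<omega> $ i $ j)) A" for p A e \<delta>
      by (rule main[OF that(2) \<delta>[OF that(1)]])
  qed
qed

end
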